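(* Let $(p_{\mathcal D}^n,\mathbf u_{\mathcal D}^n,\boldsymbol\lambda_{\mathcal D}^n)_{n=1,\dots,N}$, with $p^n_{\mathcal D}\in X^0_{\mathcal D}$, $\mathbf u^n_{\mathcal D}\in \mathbf U^0_{\mathcal D}$ and $\boldsymbol\lambda^n_{\mathcal D}\in \mathbf C_{\mathcal D}(\lambda^n_{\mathcal D,\mathbf n})$, be any solution of the fully coupled scheme (the flow equation (F), the mechanical equation (Me), the contact equations (Ct) and the coupling laws (Co) of the context). Then, for all $n=1,\dots,N$, the following discrete energy estimate holds: $$ \begin{aligned} &\delta_t^n\Big[\int_\Omega \tfrac12\Big(\sigma_{\mathcal D}(\mathbf u_{\mathcal D}):\epsilon_{\mathcal D}(\mathbf u_{\mathcal D})+\tfrac1M|\Pi_{\mathcal D_m}p_{\mathcal D_m}|^2\Big)+\tfrac12 S_{\mu,\lambda,\mathcal D}(\mathbf u_{\mathcal D},\mathbf u_{\mathcal D})\Big]+\int_\Gamma F\lambda^n_{\mathcal D,\mathbf n}\,\big|[\![\delta_t^n\mathbf u_{\mathcal D}]\!]_{\mathcal D,\boldsymbol\tau}\big|\\ &+\int_\Omega\frac{\mathbb K_m}{\eta}\nabla_{\mathcal D_m}p^n_{\mathcal D_m}\cdot\nabla_{\mathcal D_m}p^n_{\mathcal D_m}+\int_\Gamma\frac{C^{n-1}_{f,\mathcal D}}{\eta}|\nabla_{\mathcal D_f}p^n_{\mathcal D_f}|^2+\sum_{\mathfrak a\in\{+,-\}}\int_\Gamma\Lambda^{n-1}_{f,\mathcal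 D}\big([\![p^n_{\mathcal D}]\!]^{\mathfrak a}_{\mathcal D}\big)^2\\ &\le \int_\Omega h_m\,\Pi_{\mathcal D_m}p^n_{\mathcal D_m}+\int_\Gamma h_f\,\Pi_{\mathcal D_f}p^n_{\mathcal D_f}+\sum_{K\in\mathcal M}\int_K\mathbf f^n_K\cdot\Pi_{\mathcal D}\delta^n_t\mathbf u_{\mathcal D}. \end{aligned} $$ In addition, the discrete fracture aperture satisfies the lower bound $\mathrm d^n_{f,\mathcal D}\ge \mathrm d^c_{f,\mathcal D}$ on $\Gamma$, which ensures the positivity of the fracture conductivity $C^{n-1}_{f,\mathcal D}$ and of the normal transmissivity $\Lambda^{n-1}_{f,\mathcal D}$.
   Context: **Geometry and mesh.** $\Omega\subset\mathbb R^d$, $d\in\{2,3\}$, is a bounded polytopal domain; $\overline\Gamma=\bigcup_{i\in I}\overline\Gamma_i\subset\overline\Omega$ is a fracture network, each $\Gamma_i\subset\Omega$ being a planar polygonal simply connected open $(d-1)$-dimensional set (finite $I$). The two sides of $\Gamma$ are labelled $\pm$, with unit normals $\mathbf n^\pm$ pointing outward from the side $\pm$ (so $\mathbf n^-=-\mathbf n^+$). A conforming polytopal mesh of $\Omega$ is given, with finite sets of (open, connected) cells $\mathcal M$, planar faces $\mathcal F$, edges $\mathcal E$ and nodes $\mathcal V$; $\mathbf x_s$ is the position of node $s$. $\mathcal F_K,\mathcal V_K$ are the faces and nodes of the cell $K$; $\mathcal E_\sigma,\mathcal V_\sigma$ the edges and nodes of the face $\sigma$; $\mathcal M_s$ (resp.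 $\mathcal M_\sigma$) the cells containing $s$ (resp. $\sigma$) in their closure. Superscript "ext" denotes the elements lying on $\partial\Omega$. $h_K$ is the diameter of $K$; $|K|,|\sigma|,|e|$ are measures. The mesh is conforming to $\Gamma$: there is a set $\mathcal F_\Gamma$ of interior faces with $\overline\Gamma=\bigcup_{\sigma\in\mathcal F_\Gamma}\overline\sigma$; $\mathcal E_\Gamma$ is the set of edges contained in $\overline\Gamma$. An interior face shared by $K$ and $L$ is written $\sigma=K|L$; for $\sigma\in\mathcal F_\Gamma$ the cells are ordered so that $\mathbf n_{K\sigma}=\mathbf n^+$, $\mathbf n_{L\sigma}=\mathbf n^-$, where $\mathbf n_{K\sigma}$ is the unit normal to $\sigma$ outward from $K$. $\mathcal F^+_{\Gamma,K}=\{\sigma\in\mathcal F_\Gamma\cap\mathcal F_K:\mathbf n_{K\sigma}\cdot\mathbf n^+>0\}$. $\mathbf n_{\sigma e}$ is the unit normal to $e\in\mathcal E_\sigma$ in the plane of $\sigma$, outward to $\sigma$. (If $d=2$, the edges of a face are its end points: for $e=\{s\}$, $|e|=1$ and $s_1=s_2=s$ in the formulas below.) **Time.** $0=t^0<\dots<t^N=T$, $\Delta t^n=t^n-t^{n-1}$, and $\delta_t^nw=(w^n-w^{n-1})/\Delta t^n$ for any family $w=(w^n)_{n=0,\dots,N}$. **Data.** $\mu,\lambda$ are cell-wise constant Lamé parameters (values $\mu_K>0$, $\lambda_K$ with $2\mu_K+d\lambda_K>0$), $\mathbb K_m$ is a cell-wise constant symmetric positive definite tensor, $\eta>0$, $M>0$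 and $b$ are constants, $F\ge0$ and $K_{f,\mathbf n}>0$ are face-wise constant on $\Gamma$, $\mathrm d^c_{f,\mathcal D}>0$ (contact aperture) is face-wise constant on $\Gamma$; $h_m$, $h_f$ are the source terms (on $\Omega$ and $\Gamma$), and $\mathbf f^n_K=\frac1{|K|\Delta t^n}\int_{t^{n-1}}^{t^n}\int_K\mathbf f$ with a given body force $\mathbf f$. Initial data $\mathbf u_{\mathcal D}^0\in\mathbf U^0_{\mathcal D}$, $p^0_{\mathcal D}\in X_{\mathcal D}$ and a cell-wise constant initial porosity $\phi^0_{\mathcal D}$ are given. **Discrete pressures.** $X_{\mathcal D}=X_{\mathcal D_m}\times X_{\mathcal D_f}$, where elements of $X_{\mathcal D_m}$ are $p_{\mathcal D_m}=((p_K)_{K\in\mathcal M},(p_\sigma)_{\sigma\in\mathcal F\setminus\mathcal F_\Gamma},(p_{K\sigma})_{\sigma\in\mathcal F_\Gamma,K\in\mathcal M_\sigma})$ and elements of $X_{\mathcal D_f}$ are $p_{\mathcal D_f}=((p_\sigma)_{\sigma\in\mathcal F_\Gamma},(p_e)_{e\in\mathcal E_\Gamma})$, all entries real. $X^0_{\mathcal D}$ is the subspace where $p_\sigma=0$ for $\sigma\in\mathcal F^{\rm ext}$ and $p_e=0$ for $e\in\mathcal E^{\rm ext}\cap\mathcal E_\Gamma$. $\Pi_{\mathcal D_m}q_{\mathcal D_m}=q_K$ on $K$; $\Pi_{\mathcal D_f}q_{\mathcal D_f}=q_\sigma$ on $\sigma\in\mathcal F_\Gamma$; for $\sigma=K|L\in\mathcal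 F_\Gamma$, on $\sigma$, $[\![q_{\mathcal D}]\!]^+_{\mathcal D}=q_{K\sigma}-q_\sigma$ and $[\![q_{\mathcal D}]\!]^-_{\mathcal D}=q_{L\sigma}-q_\sigma$. $\nabla_{\mathcal D_m}:X_{\mathcal D_m}\to L^2(\Omega)^d$ and $\nabla_{\mathcal D_f}:X_{\mathcal D_f}\to L^2(\Gamma)^{d-1}$ are fixed linear (Hybrid Finite Volume) gradient reconstructions such that, for suitable symmetric positive definite matrices $(\mathbb T_K^{\nu\nu'})$ and $(\mathbb T_\sigma^{ee'})$ (the latter depending on the face-wise constant conductivity $C_{f,\mathcal D}$), $\int_K\mathbb K_m\nabla_{\mathcal D_m}p_{\mathcal D_m}\cdot\nabla_{\mathcal D_m}q_{\mathcal D_m}=\sum_{\nu,\nu'\in I_K}\mathbb T_K^{\nu\nu'}(p_\nu-p_K)(q_{\nu'}-q_K)$ with $I_K=(\mathcal F_K\setminus\mathcal F_\Gamma)\cup\{K\sigma:\sigma\in\mathcal F_K\cap\mathcal F_\Gamma\}$, and $\int_\sigma C_{f,\mathcal D}\nabla_{\mathcal D_f}p_{\mathcal D_f}\cdot\nabla_{\mathcal D_f}q_{\mathcal D_f}=\sum_{e,e'\in\mathcal E_\sigma}\mathbb T_\sigma^{ee'}(p_{e'}-p_\sigma)(q_e-q_\sigma)$. **Discrete displacements.** For $s\in\mathcal V$ and $K\in\mathcal M_s$, $\mathcal Ks\subset\mathcal M_s$ is the set of cells of $\mathcal M_s$ contained in the same connected component of $(\bigcup_{L\in\mathcal M_s}\overline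 L)\setminus\overline\Gamma$ as $K$ (cells on the same side of the fractures as $K$), and $\overline{\mathcal M}_s$ is the partition of $\mathcal M_s$ made of these sets. $\mathbf U_{\mathcal D}$ is the space of vectors $\mathbf v_{\mathcal D}=\big((\mathbf v_{\mathcal Ks})_{\mathcal Ks\in\overline{\mathcal M}_s,s\in\mathcal V},(\mathbf v_{K\sigma})_{\sigma\in\mathcal F^+_{\Gamma,K},K\in\mathcal M}\big)$ with entries in $\mathbb R^d$ (the $\mathbf v_{K\sigma}$ are bubble unknowns); $\mathbf U^0_{\mathcal D}$ is the subspace with $\mathbf v_{\mathcal Ks}=0$ for $s\in\mathcal V^{\rm ext}$. Fix nonnegative weights with $\sum_{s\in\mathcal V_\sigma}\omega^\sigma_s=1$, $\overline{\mathbf x}_\sigma=\sum_{s\in\mathcal V_\sigma}\omega^\sigma_s\mathbf x_s$ the center of mass of $\sigma$, and $\sum_{s\in\mathcal V_K}\omega_s^K=1$, $\overline{\mathbf x}_K=\sum_{s\in\mathcal V_K}\omega_s^K\mathbf x_s$ the center of mass of $K$. Set $\overline{\mathbf v}_{K\sigma}=\sum_{s\in\mathcal V_\sigma}\omega_s^\sigma\mathbf v_{\mathcal Ks}$, $\overline{\mathbf v}_K=\sum_{s\in\mathcal V_K}\omega_s^K\mathbf v_{\mathcal Ks}$ and - $\nabla^{K\sigma}\mathbf v_{\mathcal D}=\frac1{|\sigma|}\sum_{e=s_1s_2\in\mathcal E_\sigma}|e|\frac{\mathbf v_{\mathcal Ks_1}+\mathbf v_{\mathcal Ks_2}}2\otimes\mathbf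 n_{\sigma e}$, $\ \Pi^{K\sigma}\mathbf v_{\mathcal D}(\mathbf x)=\nabla^{K\sigma}\mathbf v_{\mathcal D}(\mathbf x-\overline{\mathbf x}_\sigma)+\overline{\mathbf v}_{K\sigma}$; - $\nabla^K\mathbf v_{\mathcal D}=\sum_{\sigma\in\mathcal F^+_{\Gamma,K}}\frac{|\sigma|}{|K|}\mathbf v_{K\sigma}\otimes\mathbf n_{K\sigma}+\sum_{\sigma\in\mathcal F_K}\frac{|\sigma|}{|K|}\overline{\mathbf v}_{K\sigma}\otimes\mathbf n_{K\sigma}$, $\ \Pi^K\mathbf v_{\mathcal D}(\mathbf x)=\nabla^K\mathbf v_{\mathcal D}(\mathbf x-\overline{\mathbf x}_K)+\overline{\mathbf v}_K$; - for $\sigma=K|L\in\mathcal F_\Gamma$: $[\![\mathbf v_{\mathcal D}]\!]_\sigma=\frac1{|\sigma|}\int_\sigma(\Pi^{K\sigma}\mathbf v_{\mathcal D}-\Pi^{L\sigma}\mathbf v_{\mathcal D})+\mathbf v_{K\sigma}$. Globally, on each $K$: $\Pi_{\mathcal D}\mathbf v_{\mathcal D}=\Pi^K\mathbf v_{\mathcal D}$, $\nabla_{\mathcal D}\mathbf v_{\mathcal D}=\nabla^K\mathbf v_{\mathcal D}$; $\epsilon_{\mathcal D}=\frac12(\nabla_{\mathcal D}+{}^t\nabla_{\mathcal D})$, $\mathrm{div}_{\mathcal D}=\mathrm{Tr}(\epsilon_{\mathcal D})$, $\sigma_{\mathcal D}=2\mu\,\epsilon_{\mathcal D}+\lambda\,\mathrm{div}_{\mathcal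 D}\,\mathbb I$. On each $\sigma\in\mathcal F_\Gamma$: $[\![\mathbf v_{\mathcal D}]\!]_{\mathcal D}=[\![\mathbf v_{\mathcal D}]\!]_\sigma$, with $[\![\mathbf v_{\mathcal D}]\!]_{\mathcal D,\mathbf n}=[\![\mathbf v_{\mathcal D}]\!]_{\mathcal D}\cdot\mathbf n^+$ and $[\![\mathbf v_{\mathcal D}]\!]_{\mathcal D,\boldsymbol\tau}=[\![\mathbf v_{\mathcal D}]\!]_{\mathcal D}-[\![\mathbf v_{\mathcal D}]\!]_{\mathcal D,\mathbf n}\mathbf n^+$. Stabilisation: $S_K(\mathbf u_{\mathcal D},\mathbf v_{\mathcal D})=h_K^{d-2}\sum_{s\in\mathcal V_K}(\mathbf u_{\mathcal Ks}-\Pi^K\mathbf u_{\mathcal D}(\mathbf x_s))\cdot(\mathbf v_{\mathcal Ks}-\Pi^K\mathbf v_{\mathcal D}(\mathbf x_s))+h_K^{d-2}\sum_{\sigma\in\mathcal F^+_{\Gamma,K}}\mathbf u_{K\sigma}\cdot\mathbf v_{K\sigma}$ and $S_{\mu,\lambda,\mathcal D}=\sum_{K\in\mathcal M}(2\mu_K+\lambda_K)S_K$. **Lagrange multipliers.** $\mathbf M_{\mathcal D}$ is the space of functions $\Gamma\to\mathbb R^d$ constant on each $\sigma\in\mathcal F_\Gamma$; $\lambda_{\mathcal D,\mathbf n}=\boldsymbol\lambda_{\mathcal D}\cdot\mathbf n^+$, $\boldsymbol\lambda_{\mathcal D,\boldsymbol\tau}=\boldsymbol\lambda_{\mathcal D}-\lambda_{\mathcal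 D,\mathbf n}\mathbf n^+$; $\mathbf C_{\mathcal D}(\lambda_{\mathcal D,\mathbf n})=\{\boldsymbol\mu_{\mathcal D}\in\mathbf M_{\mathcal D}:\mu_{\mathcal D,\mathbf n}\ge0,\ |\boldsymbol\mu_{\mathcal D,\boldsymbol\tau}|\le F\lambda_{\mathcal D,\mathbf n}\}$. **Scheme**, for all $n=1,\dots,N$: (F) for all $q_{\mathcal D}\in X^0_{\mathcal D}$: $\int_\Omega\big(\delta^n_t\phi_{\mathcal D}\,\Pi_{\mathcal D_m}q_{\mathcal D_m}+\frac{\mathbb K_m}\eta\nabla_{\mathcal D_m}p^n_{\mathcal D_m}\cdot\nabla_{\mathcal D_m}q_{\mathcal D_m}\big)+\int_\Gamma\big(\delta^n_t\mathrm d_{f,\mathcal D}\,\Pi_{\mathcal D_f}q_{\mathcal D_f}+\frac{C^{n-1}_{f,\mathcal D}}\eta\nabla_{\mathcal D_f}p^n_{\mathcal D_f}\cdot\nabla_{\mathcal D_f}q_{\mathcal D_f}\big)+\sum_{\mathfrak a\in\{+,-\}}\int_\Gamma\Lambda^{n-1}_{f,\mathcal D}[\![p^n_{\mathcal D}]\!]^{\mathfrak a}_{\mathcal D}[\![q_{\mathcal D}]\!]^{\mathfrak a}_{\mathcal D}=\int_\Omega h_m\Pi_{\mathcal D_m}q_{\mathcal D_m}+\int_\Gamma h_f\Pi_{\mathcal D_f}q_{\mathcal D_f}$, where $C^n_{f,\mathcal D}=(\mathrm d^n_{f,\mathcal D})^3/12$ and $\Lambda^n_{f,\mathcal D}=2K_{f,\mathbf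 n}/\mathrm d^n_{f,\mathcal D}$. (Me) for all $\mathbf v_{\mathcal D}\in\mathbf U^0_{\mathcal D}$: $\int_\Omega\sigma_{\mathcal D}(\mathbf u^n_{\mathcal D}):\epsilon_{\mathcal D}(\mathbf v_{\mathcal D})+S_{\mu,\lambda,\mathcal D}(\mathbf u^n_{\mathcal D},\mathbf v_{\mathcal D})-\int_\Omega b\,\Pi_{\mathcal D_m}p^n_{\mathcal D_m}\mathrm{div}_{\mathcal D}\mathbf v_{\mathcal D}+\int_\Gamma\Pi_{\mathcal D_f}p^n_{\mathcal D_f}[\![\mathbf v_{\mathcal D}]\!]_{\mathcal D,\mathbf n}+\int_\Gamma\boldsymbol\lambda^n_{\mathcal D}\cdot[\![\mathbf v_{\mathcal D}]\!]_{\mathcal D}=\sum_{K\in\mathcal M}\int_K\mathbf f^n_K\cdot\Pi_{\mathcal D}\mathbf v_{\mathcal D}$. (Ct) on $\Gamma$: $\lambda^n_{\mathcal D,\mathbf n}=[\lambda^n_{\mathcal D,\mathbf n}+\beta_{\mathcal D,\mathbf n}[\![\mathbf u^n_{\mathcal D}]\!]_{\mathcal D,\mathbf n}]_{\mathbb R^+}$ and $\boldsymbol\lambda^n_{\mathcal D,\boldsymbol\tau}=[\boldsymbol\lambda^n_{\mathcal D,\boldsymbol\tau}+\beta_{\mathcal D,\boldsymbol\tau}[\![\delta^n_t\mathbf u_{\mathcal D}]\!]_{\mathcal D,\boldsymbol\tau}]_{F\lambda^n_{\mathcal D,\mathbf n}}$, where $\beta_{\mathcal D,\mathbf n},\beta_{\mathcal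 D,\boldsymbol\tau}>0$ are arbitrary face-wise constant functions, $[x]_{\mathbb R^+}=\max\{0,x\}$, and $[\cdot]_\alpha$ is the projection onto the closed ball of radius $\alpha$ centered at $0$. (Co) $\delta^n_t\phi_{\mathcal D}=b\,\mathrm{div}_{\mathcal D}(\delta^n_t\mathbf u_{\mathcal D})+\frac1M\Pi_{\mathcal D_m}\delta^n_tp_{\mathcal D_m}$ for $n\ge1$, and $\mathrm d^n_{f,\mathcal D}=\mathrm d^c_{f,\mathcal D}-[\![\mathbf u^n_{\mathcal D}]\!]_{\mathcal D,\mathbf n}$ for all $n\ge0$.
   Formalization: For n=1, the energy estimate and the positivity of C^0_f and Λ^0_f are proved under the added assumption that the initial displacement has nonpositive normal jump on Γ (so d^0_f ≥ d^c_f); for arbitrary u^0 in U^0_D these claims are false. *)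

theory Defs
  imports "HOL-Analysis.Analysis"
begin

section \<open>Flat polytopal sets, normals and surface measure\<close>

(* A k-dimensional polytopal set: connected, nonempty, and the interior (relative to a
   k-dimensional affine subspace) of a finite union of convex polytopes. It need not be convex,
   but it cannot contain both sides of one of its boundary facets. For k = 0 it is a point,
   for k = 1 a bounded open segment. *)
definition polytopal :: "int \<Rightarrow> 'a::euclidean_space set \<Rightarrow> bool" where
  "polytopal k S \<longleftrightarrow> S \<noteq> {} \<and> connected S \<and>
     (\<exists>H P. affine H \<and> aff_dim H = k \<and> finite P \<and> (\<forall>C\<in>P. polytope C \<and> C \<subseteq> H) \<and>
            S = (top_of_set H) interior_of (\<Union>P))"

(* Unit normal to the flat boundary piece T of S, taken in the affine hull of S and pointing out
   of S. With S a cell and T a face this is n_{K sigma}; with S a face and T an edge it is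
   n_{sigma e}. *)
definition outward_normal :: "'a::euclidean_space set \<Rightarrow> 'a set \<Rightarrow> 'a" where
  "outward_normal S T = (THE n. norm n = 1 \<and> n \<in> span {x - y |x y. x \<in> S \<and> y \<in> S} \<and>
     (\<forall>x\<in>T. \<forall>y\<in>T. n \<bullet> (x - y) = 0) \<and>
     (\<forall>x\<in>T. \<exists>\<delta>>0. \<forall>r. 0 < r \<and> r < \<delta> \<longrightarrow> x - r *\<^sub>R n \<in> S \<and> x + r *\<^sub>R n \<notin> S))"

definition plane_normal :: "'a::euclidean_space set \<Rightarrow> 'a" where
  "plane_normal S = (SOME n. norm n = 1 \<and> (\<forall>x\<in>S. \<forall>y\<in>S. n \<bullet> (x - y) = 0))"

(* (d-1)-dimensional Lebesgue measure of a subset S of a hyperplane: the d-dimensional Lebesgue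
   measure of the right prism of height 1 over S, projected back orthogonally onto S. *)
definition surf :: "'a::euclidean_space set \<Rightarrow> 'a measure" where
  "surf S = (let n = plane_normal S; x0 = (SOME x. x \<in> S) in
     distr (restrict_space lborel {x + r *\<^sub>R n |x r. x \<in> S \<and> 0 \<le> r \<and> r \<le> 1}) borel
           (\<lambda>z. z - ((z - x0) \<bullet> n) *\<^sub>R n))"

definition area :: "'a::euclidean_space set \<Rightarrow> real" where
  "area S = measure (surf S) UNIV"

definition volume :: "'a::euclidean_space set \<Rightarrow> real" where
  "volume K = measure lborel K"

definition tensor :: "real^'d \<Rightarrow> real^'d \<Rightarrow> real^'d^'d" (infixl "\<otimes>\<^sub>t" 75) where
  "a \<otimes>\<^sub>t b = (\<chi> i j. a $ i * b $ j)"

definition spd :: "real^'d^'d \<Rightarrow> bool" where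
  "spd A \<longleftrightarrow> transpose A = A \<and> (\<forall>x. x \<noteq> 0 \<longrightarrow> 0 < x \<bullet> (A *v x))"

definition spd_on :: "'i set \<Rightarrow> ('i \<Rightarrow> 'i \<Rightarrow> real) \<Rightarrow> bool" where
  "spd_on I A \<longleftrightarrow> (\<forall>i\<in>I. \<forall>j\<in>I. A i j = A j i) \<and>
     (\<forall>x. (\<exists>i\<in>I. x i \<noteq> 0) \<longrightarrow> 0 < (\<Sum>i\<in>I. \<Sum>j\<in>I. A i j * x i * x j))"


section \<open>Discretisation\<close>

datatype side = Plus | Minus

(* Indices of the degrees of freedom. *)
datatype 'p mdof = PCell "'p set" | PFace "'p set" | PSide "'p set" "'p set"
datatype 'p fdof = FFace "'p set" | FEdge "'p set"
datatype 'p udof = UNode "'p set set" 'p | UBubble "'p set" "'p set"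

(* Mesh elements are sets of points and nodes are points, so a node is its own position. *)
record 'p disc =
  omega :: "'p set"
  fractures :: "'p set set"
  cells :: "'p set set"
  faces :: "'p set set"
  edges :: "'p set set"
  nodes :: "'p set"
  frac_faces :: "'p set set"
  normal_plus :: "'p set \<Rightarrow> 'p"
  wface :: "'p set \<Rightarrow> 'p \<Rightarrow> real"
  wcell :: "'p set \<Rightarrow> 'p \<Rightarrow> real"
  grad_m :: "('p mdof \<Rightarrow> real) \<Rightarrow> 'p \<Rightarrow> 'p"
  grad_f :: "('p fdof \<Rightarrow> real) \<Rightarrow> 'p \<Rightarrow> 'p"

definition gamma_bar :: "(real^'d) disc \<Rightarrow> (real^'d) set" where
  "gamma_bar D = (\<Union>\<gamma>\<in>fractures D. closure \<gamma>)"

definition faces_of :: "(real^'d) disc \<Rightarrow> (real^'d) set \<Rightarrow> (real^'d) set set" where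
  "faces_of D K = {\<sigma>\<in>faces D. \<sigma> \<subseteq> frontier K}"

definition nodes_of :: "(real^'d) disc \<Rightarrow> (real^'d) set \<Rightarrow> (real^'d) set" where
  "nodes_of D S = nodes D \<inter> closure S"

definition edges_of :: "(real^'d) disc \<Rightarrow> (real^'d) set \<Rightarrow> (real^'d) set set" where
  "edges_of D \<sigma> = {e\<in>edges D. e \<subseteq> closure \<sigma> - \<sigma>}"

definition cells_of_node :: "(real^'d) disc \<Rightarrow> real^'d \<Rightarrow> (real^'d) set set" where
  "cells_of_node D s = {K\<in>cells D. s \<in> closure K}"

definition cells_of_face :: "(real^'d) disc \<Rightarrow> (real^'d) set \<Rightarrow> (real^'d) set set" where
  "cells_of_face D \<sigma> = {K\<in>cells D. \<sigma> \<subseteq> closure K}"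

definition ext_faces :: "(real^'d) disc \<Rightarrow> (real^'d) set set" where
  "ext_faces D = {\<sigma>\<in>faces D. \<sigma> \<subseteq> frontier (omega D)}"

definition ext_edges :: "(real^'d) disc \<Rightarrow> (real^'d) set set" where
  "ext_edges D = {e\<in>edges D. e \<subseteq> frontier (omega D)}"

definition ext_nodes :: "(real^'d) disc \<Rightarrow> (real^'d) set" where
  "ext_nodes D = nodes D \<inter> frontier (omega D)"

definition frac_edges :: "(real^'d) disc \<Rightarrow> (real^'d) set set" where
  "frac_edges D = {e\<in>edges D. e \<subseteq> gamma_bar D}"

definition end_points :: "'a::euclidean_space set \<Rightarrow> 'a set" where
  "end_points e = {x. x extreme_point_of closure e}"

(* (d-2)-dimensional measure of an edge: its length if d = 3, and 1 if d = 2. *)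
definition edge_measure :: "(real^'d) set \<Rightarrow> real" where
  "edge_measure e = (if CARD('d) = 2 then 1 else diameter e)"

definition polytopal_mesh :: "(real^'d) disc \<Rightarrow> bool" where
  "polytopal_mesh D \<longleftrightarrow>
     polytopal (int CARD('d)) (omega D) \<and>
     \<comment> \<open>cells\<close>
     finite (cells D) \<and> (\<forall>K\<in>cells D. polytopal (int CARD('d)) K) \<and> disjoint (cells D) \<and>
     closure (omega D) = (\<Union>K\<in>cells D. closure K) \<and>
     \<comment> \<open>faces\<close>
     finite (faces D) \<and> (\<forall>\<sigma>\<in>faces D. polytopal (int CARD('d) - 1) \<sigma>) \<and> disjoint (faces D) \<and>
     \<Union>(faces D) \<inter> \<Union>(cells D) = {} \<and>
     (\<forall>K\<in>cells D. frontier K = (\<Union>\<sigma>\<in>faces_of D K. closure \<sigma>)) \<and>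
     (\<forall>\<sigma>\<in>faces D. \<sigma> \<subseteq> omega D \<and> card (cells_of_face D \<sigma>) = 2
                 \<or> \<sigma> \<subseteq> frontier (omega D) \<and> card (cells_of_face D \<sigma>) = 1) \<and>
     \<comment> \<open>edges\<close>
     finite (edges D) \<and> (\<forall>e\<in>edges D. polytopal (int CARD('d) - 2) e) \<and> disjoint (edges D) \<and>
     \<Union>(edges D) \<inter> \<Union>(faces D) = {} \<and>
     (\<forall>\<sigma>\<in>faces D. closure \<sigma> - \<sigma> = (\<Union>e\<in>edges_of D \<sigma>. closure e)) \<and>
     (\<forall>e\<in>edges D. \<exists>\<sigma>\<in>faces D. e \<in> edges_of D \<sigma>) \<and>
     \<comment> \<open>nodes\<close>
     nodes D = (\<Union>e\<in>edges D. end_points e) \<and>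
     (\<forall>e\<in>edges D. nodes_of D e = end_points e) \<and>
     nodes D \<inter> \<Union>(faces D) = {} \<and> nodes D \<inter> \<Union>(cells D) = {}"

(* The labelling of the two sides is encoded by the unit normal n^+ on the fracture faces: it is
   the outward normal of one of the two neighbouring cells, and does not flip along a planar
   fracture. *)
definition fracture_network :: "(real^'d) disc \<Rightarrow> bool" where
  "fracture_network D \<longleftrightarrow>
     finite (fractures D) \<and>
     (\<forall>\<gamma>\<in>fractures D. polytopal (int CARD('d) - 1) \<gamma> \<and> simply_connected \<gamma> \<and> \<gamma> \<subseteq> omega D) \<and>
     frac_faces D \<subseteq> {\<sigma>\<in>faces D. \<sigma> \<subseteq> omega D} \<and>
     gamma_bar D = (\<Union>\<sigma>\<in>frac_faces D. closure \<sigma>) \<and>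
     (\<forall>\<sigma>\<in>frac_faces D. norm (normal_plus D \<sigma>) = 1) \<and>
     (\<forall>\<sigma>\<in>frac_faces D. \<exists>K\<in>cells_of_face D \<sigma>. normal_plus D \<sigma> = outward_normal K \<sigma>) \<and>
     (\<forall>\<gamma>\<in>fractures D. \<forall>\<sigma>\<in>frac_faces D. \<forall>\<tau>\<in>frac_faces D.
        \<sigma> \<subseteq> closure \<gamma> \<and> \<tau> \<subseteq> closure \<gamma> \<longrightarrow> normal_plus D \<sigma> = normal_plus D \<tau>)"

definition face_center :: "(real^'d) disc \<Rightarrow> (real^'d) set \<Rightarrow> real^'d" where
  "face_center D \<sigma> = (\<Sum>s\<in>nodes_of D \<sigma>. wface D \<sigma> s *\<^sub>R s)"

definition cell_center :: "(real^'d) disc \<Rightarrow> (real^'d) set \<Rightarrow> real^'d" where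
  "cell_center D K = (\<Sum>s\<in>nodes_of D K. wcell D K s *\<^sub>R s)"

definition center_weights :: "(real^'d) disc \<Rightarrow> bool" where
  "center_weights D \<longleftrightarrow>
     (\<forall>\<sigma>\<in>faces D. (\<forall>s\<in>nodes_of D \<sigma>. 0 \<le> wface D \<sigma> s) \<and> (\<Sum>s\<in>nodes_of D \<sigma>. wface D \<sigma> s) = 1 \<and>
        face_center D \<sigma> = (1 / area \<sigma>) *\<^sub>R (LINT x|surf \<sigma>. x)) \<and>
     (\<forall>K\<in>cells D. (\<forall>s\<in>nodes_of D K. 0 \<le> wcell D K s) \<and> (\<Sum>s\<in>nodes_of D K. wcell D K s) = 1 \<and>
        cell_center D K = (1 / volume K) *\<^sub>R (LINT x:K|lborel. x))"

(* For sigma = K|L in F_Gamma: Plus gives K (n_{K sigma} = n^+), Minus gives L. *)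
definition side_cell :: "(real^'d) disc \<Rightarrow> side \<Rightarrow> (real^'d) set \<Rightarrow> (real^'d) set" where
  "side_cell D a \<sigma> = (THE K. K \<in> cells_of_face D \<sigma> \<and>
     outward_normal K \<sigma> = (case a of Plus \<Rightarrow> normal_plus D \<sigma> | Minus \<Rightarrow> - normal_plus D \<sigma>))"

definition plus_faces :: "(real^'d) disc \<Rightarrow> (real^'d) set \<Rightarrow> (real^'d) set set" where
  "plus_faces D K = {\<sigma>\<in>frac_faces D \<inter> faces_of D K. outward_normal K \<sigma> \<bullet> normal_plus D \<sigma> > 0}"

definition cellwise :: "(real^'d) disc \<Rightarrow> ((real^'d) set \<Rightarrow> 'b::real_vector) \<Rightarrow> real^'d \<Rightarrow> 'b" where
  "cellwise D \<phi> x = (\<Sum>K\<in>cells D. if x \<in> K then \<phi> K else 0)"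

definition facewise :: "(real^'d) disc \<Rightarrow> ((real^'d) set \<Rightarrow> 'b::real_vector) \<Rightarrow> real^'d \<Rightarrow> 'b" where
  "facewise D \<phi> x = (\<Sum>\<sigma>\<in>frac_faces D. if x \<in> \<sigma> then \<phi> \<sigma> else 0)"

definition int_omega :: "(real^'d) disc \<Rightarrow> (real^'d \<Rightarrow> real) \<Rightarrow> real" where
  "int_omega D w = (LINT x:omega D|lborel. w x)"

definition int_gamma :: "(real^'d) disc \<Rightarrow> (real^'d \<Rightarrow> real) \<Rightarrow> real" where
  "int_gamma D w = (\<Sum>\<sigma>\<in>frac_faces D. LINT x|surf \<sigma>. w x)"


section \<open>Discrete pressures\<close>

definition mdofs :: "(real^'d) disc \<Rightarrow> (real^'d) mdof set" where
  "mdofs D = PCell ` cells D \<union> PFace ` (faces D - frac_faces D) \<union>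
     {PSide K \<sigma> |K \<sigma>. \<sigma> \<in> frac_faces D \<and> K \<in> cells_of_face D \<sigma>}"

definition fdofs :: "(real^'d) disc \<Rightarrow> (real^'d) fdof set" where
  "fdofs D = FFace ` frac_faces D \<union> FEdge ` frac_edges D"

(* A family indexed by a set of degrees of freedom is a function vanishing off that set. *)
definition X_m :: "(real^'d) disc \<Rightarrow> ((real^'d) mdof \<Rightarrow> real) set" where
  "X_m D = {q. \<forall>\<nu>. \<nu> \<notin> mdofs D \<longrightarrow> q \<nu> = 0}"

definition X_f :: "(real^'d) disc \<Rightarrow> ((real^'d) fdof \<Rightarrow> real) set" where
  "X_f D = {q. \<forall>\<nu>. \<nu> \<notin> fdofs D \<longrightarrow> q \<nu> = 0}"

definition X_D :: "(real^'d) disc \<Rightarrow> (((real^'d) mdof \<Rightarrow> real) \<times> ((real^'d) fdof \<Rightarrow> real)) set" where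
  "X_D D = X_m D \<times> X_f D"

definition X_D0 :: "(real^'d) disc \<Rightarrow> (((real^'d) mdof \<Rightarrow> real) \<times> ((real^'d) fdof \<Rightarrow> real)) set" where
  "X_D0 D = {q\<in>X_D D. (\<forall>\<sigma>\<in>ext_faces D. fst q (PFace \<sigma>) = 0) \<and>
                      (\<forall>e\<in>ext_edges D \<inter> frac_edges D. snd q (FEdge e) = 0)}"

definition Pi_m :: "(real^'d) disc \<Rightarrow> ((real^'d) mdof \<Rightarrow> real) \<Rightarrow> real^'d \<Rightarrow> real" where
  "Pi_m D q = cellwise D (\<lambda>K. q (PCell K))"

definition Pi_f :: "(real^'d) disc \<Rightarrow> ((real^'d) fdof \<Rightarrow> real) \<Rightarrow> real^'d \<Rightarrow> real" where
  "Pi_f D q = facewise D (\<lambda>\<sigma>. q (FFace \<sigma>))"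

definition pjump :: "(real^'d) disc \<Rightarrow> side \<Rightarrow>
    ((real^'d) mdof \<Rightarrow> real) \<times> ((real^'d) fdof \<Rightarrow> real) \<Rightarrow> real^'d \<Rightarrow> real" where
  "pjump D a q = facewise D (\<lambda>\<sigma>. fst q (PSide (side_cell D a \<sigma>) \<sigma>) - snd q (FFace \<sigma>))"

definition I_K :: "(real^'d) disc \<Rightarrow> (real^'d) set \<Rightarrow> (real^'d) mdof set" where
  "I_K D K = PFace ` (faces_of D K - frac_faces D) \<union> PSide K ` (faces_of D K \<inter> frac_faces D)"

(* Linear maps into L^2(Omega)^d and L^2(Gamma)^(d-1), the latter realised as square integrable
   vector fields tangent to the faces. Elements of L^2 are represented by Borel functions, hence
   linearity is required almost everywhere only. *)
definition hfv_gradients :: "(real^'d) disc \<Rightarrow> ((real^'d) set \<Rightarrow> real^'d^'d) \<Rightarrow> bool" where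
  "hfv_gradients D Km \<longleftrightarrow>
     (\<forall>q\<in>X_m D. set_borel_measurable lborel (omega D) (grad_m D q) \<and>
        set_integrable lborel (omega D) (\<lambda>x. (norm (grad_m D q x))\<^sup>2)) \<and>
     (\<forall>p\<in>X_m D. \<forall>q\<in>X_m D. \<forall>a b. AE x in lborel. x \<in> omega D \<longrightarrow>
        grad_m D (\<lambda>\<nu>. a * p \<nu> + b * q \<nu>) x = a *\<^sub>R grad_m D p x + b *\<^sub>R grad_m D q x) \<and>
     (\<forall>K\<in>cells D. \<exists>T. spd_on (I_K D K) T \<and> (\<forall>p\<in>X_m D. \<forall>q\<in>X_m D.
        (LINT x:K|lborel. (Km K *v grad_m D p x) \<bullet> grad_m D q x) =
        (\<Sum>\<nu>\<in>I_K D K. \<Sum>\<nu>'\<in>I_K D K. T \<nu> \<nu>' * (p \<nu> - p (PCell K)) * (q \<nu>' - q (PCell K))))) \<and>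
     (\<forall>\<sigma>\<in>frac_faces D. \<forall>q\<in>X_f D. grad_f D q \<in> borel_measurable (surf \<sigma>) \<and>
        integrable (surf \<sigma>) (\<lambda>x. (norm (grad_f D q x))\<^sup>2) \<and>
        (AE x in surf \<sigma>. grad_f D q x \<bullet> normal_plus D \<sigma> = 0)) \<and>
     (\<forall>\<sigma>\<in>frac_faces D. \<forall>p\<in>X_f D. \<forall>q\<in>X_f D. \<forall>a b. AE x in surf \<sigma>.
        grad_f D (\<lambda>\<nu>. a * p \<nu> + b * q \<nu>) x = a *\<^sub>R grad_f D p x + b *\<^sub>R grad_f D q x) \<and>
     (\<forall>\<sigma>\<in>frac_faces D. \<forall>c>0. \<exists>T. spd_on (edges_of D \<sigma>) T \<and> (\<forall>p\<in>X_f D. \<forall>q\<in>X_f D.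
        (LINT x|surf \<sigma>. c * (grad_f D p x \<bullet> grad_f D q x)) =
        (\<Sum>e\<in>edges_of D \<sigma>. \<Sum>e'\<in>edges_of D \<sigma>. T e e' *
           (p (FEdge e') - p (FFace \<sigma>)) * (q (FEdge e) - q (FFace \<sigma>)))))"


section \<open>Discrete displacements\<close>

definition same_side :: "(real^'d) disc \<Rightarrow> (real^'d) set \<Rightarrow> real^'d \<Rightarrow> (real^'d) set set" where
  "same_side D K s = {L\<in>cells_of_node D s.
     \<exists>C\<in>components ((\<Union>L\<in>cells_of_node D s. closure L) - gamma_bar D). K \<subseteq> C \<and> L \<subseteq> C}"

definition udofs :: "(real^'d) disc \<Rightarrow> (real^'d) udof set" where
  "udofs D = {UNode (same_side D K s) s |K s. s \<in> nodes D \<and> K \<in> cells_of_node D s} \<union>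
     {UBubble K \<sigma> |K \<sigma>. K \<in> cells D \<and> \<sigma> \<in> plus_faces D K}"

definition U_D :: "(real^'d) disc \<Rightarrow> ((real^'d) udof \<Rightarrow> real^'d) set" where
  "U_D D = {v. \<forall>\<nu>. \<nu> \<notin> udofs D \<longrightarrow> v \<nu> = 0}"

definition U_D0 :: "(real^'d) disc \<Rightarrow> ((real^'d) udof \<Rightarrow> real^'d) set" where
  "U_D0 D = {v\<in>U_D D. \<forall>s\<in>ext_nodes D. \<forall>K\<in>cells_of_node D s. v (UNode (same_side D K s) s) = 0}"

definition node_val ::
    "(real^'d) disc \<Rightarrow> ((real^'d) udof \<Rightarrow> real^'d) \<Rightarrow> (real^'d) set \<Rightarrow> real^'d \<Rightarrow> real^'d" where
  "node_val D v K s = v (UNode (same_side D K s) s)"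

definition face_mean ::
    "(real^'d) disc \<Rightarrow> ((real^'d) udof \<Rightarrow> real^'d) \<Rightarrow> (real^'d) set \<Rightarrow> (real^'d) set \<Rightarrow> real^'d" where
  "face_mean D v K \<sigma> = (\<Sum>s\<in>nodes_of D \<sigma>. wface D \<sigma> s *\<^sub>R node_val D v K s)"

definition cell_mean ::
    "(real^'d) disc \<Rightarrow> ((real^'d) udof \<Rightarrow> real^'d) \<Rightarrow> (real^'d) set \<Rightarrow> real^'d" where
  "cell_mean D v K = (\<Sum>s\<in>nodes_of D K. wcell D K s *\<^sub>R node_val D v K s)"

(* The average over the end points of e is (v_{Ks_1} + v_{Ks_2})/2 if d = 3, and v_{Ks} for
   e = {s} if d = 2. *)
definition face_grad ::
    "(real^'d) disc \<Rightarrow> ((real^'d) udof \<Rightarrow> real^'d) \<Rightarrow> (real^'d) set \<Rightarrow> (real^'d) set \<Rightarrow> real^'d^'d" where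
  "face_grad D v K \<sigma> = (1 / area \<sigma>) *\<^sub>R (\<Sum>e\<in>edges_of D \<sigma>. edge_measure e *\<^sub>R
     (((1 / real (card (end_points e))) *\<^sub>R (\<Sum>s\<in>end_points e. node_val D v K s))
        \<otimes>\<^sub>t outward_normal \<sigma> e))"

definition face_Pi ::
    "(real^'d) disc \<Rightarrow> ((real^'d) udof \<Rightarrow> real^'d) \<Rightarrow> (real^'d) set \<Rightarrow> (real^'d) set \<Rightarrow> real^'d \<Rightarrow> real^'d"
  where
  "face_Pi D v K \<sigma> x = face_grad D v K \<sigma> *v (x - face_center D \<sigma>) + face_mean D v K \<sigma>"

definition cell_grad ::
    "(real^'d) disc \<Rightarrow> ((real^'d) udof \<Rightarrow> real^'d) \<Rightarrow> (real^'d) set \<Rightarrow> real^'d^'d" where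
  "cell_grad D v K =
     (\<Sum>\<sigma>\<in>plus_faces D K. (area \<sigma> / volume K) *\<^sub>R (v (UBubble K \<sigma>) \<otimes>\<^sub>t outward_normal K \<sigma>)) +
     (\<Sum>\<sigma>\<in>faces_of D K. (area \<sigma> / volume K) *\<^sub>R (face_mean D v K \<sigma> \<otimes>\<^sub>t outward_normal K \<sigma>))"

definition cell_Pi ::
    "(real^'d) disc \<Rightarrow> ((real^'d) udof \<Rightarrow> real^'d) \<Rightarrow> (real^'d) set \<Rightarrow> real^'d \<Rightarrow> real^'d" where
  "cell_Pi D v K x = cell_grad D v K *v (x - cell_center D K) + cell_mean D v K"

definition jump ::
    "(real^'d) disc \<Rightarrow> ((real^'d) udof \<Rightarrow> real^'d) \<Rightarrow> (real^'d) set \<Rightarrow> real^'d" where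
  "jump D v \<sigma> = (let K = side_cell D Plus \<sigma>; L = side_cell D Minus \<sigma> in
     (1 / area \<sigma>) *\<^sub>R (LINT x|surf \<sigma>. face_Pi D v K \<sigma> x - face_Pi D v L \<sigma> x) + v (UBubble K \<sigma>))"

definition normal_part :: "(real^'d) disc \<Rightarrow> (real^'d) set \<Rightarrow> real^'d \<Rightarrow> real" where
  "normal_part D \<sigma> w = w \<bullet> normal_plus D \<sigma>"

definition tangent_part :: "(real^'d) disc \<Rightarrow> (real^'d) set \<Rightarrow> real^'d \<Rightarrow> real^'d" where
  "tangent_part D \<sigma> w = w - normal_part D \<sigma> w *\<^sub>R normal_plus D \<sigma>"

definition strain ::
    "(real^'d) disc \<Rightarrow> ((real^'d) udof \<Rightarrow> real^'d) \<Rightarrow> (real^'d) set \<Rightarrow> real^'d^'d" where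
  "strain D v K = (1/2) *\<^sub>R (cell_grad D v K + transpose (cell_grad D v K))"

definition dvg ::
    "(real^'d) disc \<Rightarrow> ((real^'d) udof \<Rightarrow> real^'d) \<Rightarrow> (real^'d) set \<Rightarrow> real" where
  "dvg D v K = trace (strain D v K)"

definition Pi_D ::
    "(real^'d) disc \<Rightarrow> ((real^'d) udof \<Rightarrow> real^'d) \<Rightarrow> real^'d \<Rightarrow> real^'d" where
  "Pi_D D v x = cellwise D (\<lambda>K. cell_Pi D v K x) x"


section \<open>Data and scheme\<close>

record 'd model =
  mu :: "(real^'d) set \<Rightarrow> real"
  lam :: "(real^'d) set \<Rightarrow> real"
  perm :: "(real^'d) set \<Rightarrow> real^'d^'d"
  eta :: real
  biot_M :: real
  biot_b :: real
  fric :: "(real^'d) set \<Rightarrow> real"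
  K_fn :: "(real^'d) set \<Rightarrow> real"
  d_c :: "(real^'d) set \<Rightarrow> real"
  h_m :: "real^'d \<Rightarrow> real"
  h_f :: "real^'d \<Rightarrow> real"
  force :: "real \<Rightarrow> real^'d \<Rightarrow> real^'d"

definition admissible_data :: "(real^'d) disc \<Rightarrow> 'd model \<Rightarrow> real \<Rightarrow> bool" where
  "admissible_data D P T \<longleftrightarrow>
     (\<forall>K\<in>cells D. 0 < mu P K \<and> 0 < 2 * mu P K + real CARD('d) * lam P K \<and> spd (perm P K)) \<and>
     0 < eta P \<and> 0 < biot_M P \<and>
     (\<forall>\<sigma>\<in>frac_faces D. 0 \<le> fric P \<sigma> \<and> 0 < K_fn P \<sigma> \<and> 0 < d_c P \<sigma>) \<and>
     set_integrable lborel (omega D) (h_m P) \<and>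
     (\<forall>\<sigma>\<in>frac_faces D. integrable (surf \<sigma>) (h_f P)) \<and>
     set_integrable lborel ({0..T} \<times> omega D) (\<lambda>(r, x). force P r x)"

definition time_grid :: "(nat \<Rightarrow> real) \<Rightarrow> nat \<Rightarrow> real \<Rightarrow> bool" where
  "time_grid t N T \<longleftrightarrow> t 0 = 0 \<and> t N = T \<and> strict_mono_on {..N} t"

definition dt :: "(nat \<Rightarrow> real) \<Rightarrow> (nat \<Rightarrow> 'b::real_vector) \<Rightarrow> nat \<Rightarrow> 'b" where
  "dt t w n = (w n - w (n - 1)) /\<^sub>R (t n - t (n - 1))"

definition dt_fam :: "(nat \<Rightarrow> real) \<Rightarrow> (nat \<Rightarrow> 'i \<Rightarrow> 'b::real_vector) \<Rightarrow> nat \<Rightarrow> 'i \<Rightarrow> 'b" where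
  "dt_fam t w n i = dt t (\<lambda>m. w m i) n"

definition mean_force ::
    "'d::finite model \<Rightarrow> (nat \<Rightarrow> real) \<Rightarrow> nat \<Rightarrow> (real^'d) set \<Rightarrow> real^'d" where
  "mean_force P t n K = (1 / (volume K * (t n - t (n - 1)))) *\<^sub>R
     (LINT r:{t (n - 1)..t n}|lborel. LINT x:K|lborel. force P r x)"

definition stress ::
    "(real^'d) disc \<Rightarrow> 'd model \<Rightarrow> ((real^'d) udof \<Rightarrow> real^'d) \<Rightarrow> (real^'d) set \<Rightarrow> real^'d^'d" where
  "stress D P v K = (2 * mu P K) *\<^sub>R strain D v K + (lam P K * dvg D v K) *\<^sub>R mat 1"

definition stab_cell :: "(real^'d) disc \<Rightarrow> (real^'d) set \<Rightarrow>
    ((real^'d) udof \<Rightarrow> real^'d) \<Rightarrow> ((real^'d) udof \<Rightarrow> real^'d) \<Rightarrow> real" where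
  "stab_cell D K u v =
     diameter K ^ (CARD('d) - 2) *
       (\<Sum>s\<in>nodes_of D K. (node_val D u K s - cell_Pi D u K s) \<bullet> (node_val D v K s - cell_Pi D v K s)) +
     diameter K ^ (CARD('d) - 2) * (\<Sum>\<sigma>\<in>plus_faces D K. u (UBubble K \<sigma>) \<bullet> v (UBubble K \<sigma>))"

definition stab :: "(real^'d) disc \<Rightarrow> 'd model \<Rightarrow>
    ((real^'d) udof \<Rightarrow> real^'d) \<Rightarrow> ((real^'d) udof \<Rightarrow> real^'d) \<Rightarrow> real" where
  "stab D P u v = (\<Sum>K\<in>cells D. (2 * mu P K + lam P K) * stab_cell D K u v)"

(* Lagrange multipliers are identified with their values on the fracture faces. *)
definition C_D :: "(real^'d) disc \<Rightarrow> 'd model \<Rightarrow> ((real^'d) set \<Rightarrow> real) \<Rightarrow>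
    ((real^'d) set \<Rightarrow> real^'d) set" where
  "C_D D P \<alpha> = {m. \<forall>\<sigma>\<in>frac_faces D. 0 \<le> normal_part D \<sigma> (m \<sigma>) \<and>
                       norm (tangent_part D \<sigma> (m \<sigma>)) \<le> fric P \<sigma> * \<alpha> \<sigma>}"

definition conductivity :: "((real^'d) set \<Rightarrow> real) \<Rightarrow> (real^'d) set \<Rightarrow> real" where
  "conductivity df \<sigma> = (df \<sigma>) ^ 3 / 12"

definition transmissivity ::
    "'d::finite model \<Rightarrow> ((real^'d) set \<Rightarrow> real) \<Rightarrow> (real^'d) set \<Rightarrow> real" where
  "transmissivity P df \<sigma> = 2 * K_fn P \<sigma> / df \<sigma>"

(* In flow_eq, mech_eq and contact_eq, n is the time step; phi, df, u, p are the whole sequences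
   where a time difference occurs. *)
definition flow_eq :: "(real^'d) disc \<Rightarrow> 'd model \<Rightarrow> (nat \<Rightarrow> real) \<Rightarrow> nat \<Rightarrow>
    (nat \<Rightarrow> ((real^'d) mdof \<Rightarrow> real) \<times> ((real^'d) fdof \<Rightarrow> real)) \<Rightarrow>
    (nat \<Rightarrow> (real^'d) set \<Rightarrow> real) \<Rightarrow> (nat \<Rightarrow> (real^'d) set \<Rightarrow> real) \<Rightarrow> bool" where
  "flow_eq D P t n p \<phi> df \<longleftrightarrow> (\<forall>q\<in>X_D0 D.
     int_omega D (\<lambda>x. cellwise D (dt_fam t \<phi> n) x * Pi_m D (fst q) x
        + ((1 / eta P) *\<^sub>R (cellwise D (perm P) x *v grad_m D (fst (p n)) x)) \<bullet> grad_m D (fst q) x)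
     + int_gamma D (\<lambda>x. facewise D (dt_fam t df n) x * Pi_f D (snd q) x
        + facewise D (conductivity (df (n - 1))) x / eta P
            * (grad_f D (snd (p n)) x \<bullet> grad_f D (snd q) x))
     + (\<Sum>a\<in>{Plus, Minus}. int_gamma D (\<lambda>x. facewise D (transmissivity P (df (n - 1))) x
            * pjump D a (p n) x * pjump D a q x))
     = int_omega D (\<lambda>x. h_m P x * Pi_m D (fst q) x) + int_gamma D (\<lambda>x. h_f P x * Pi_f D (snd q) x))"

definition mech_eq :: "(real^'d) disc \<Rightarrow> 'd model \<Rightarrow> (nat \<Rightarrow> real) \<Rightarrow> nat \<Rightarrow>
    ((real^'d) mdof \<Rightarrow> real) \<times> ((real^'d) fdof \<Rightarrow> real) \<Rightarrow>
    ((real^'d) udof \<Rightarrow> real^'d) \<Rightarrow> ((real^'d) set \<Rightarrow> real^'d) \<Rightarrow> bool" where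
  "mech_eq D P t n p u l \<longleftrightarrow> (\<forall>v\<in>U_D0 D.
     int_omega D (\<lambda>x. cellwise D (stress D P u) x \<bullet> cellwise D (strain D v) x)
     + stab D P u v
     - int_omega D (\<lambda>x. biot_b P * Pi_m D (fst p) x * cellwise D (dvg D v) x)
     + int_gamma D (\<lambda>x. Pi_f D (snd p) x * facewise D (\<lambda>\<sigma>. normal_part D \<sigma> (jump D v \<sigma>)) x)
     + int_gamma D (\<lambda>x. facewise D l x \<bullet> facewise D (jump D v) x)
     = (\<Sum>K\<in>cells D. LINT x:K|lborel. mean_force P t n K \<bullet> Pi_D D v x))"

definition contact_eq :: "(real^'d) disc \<Rightarrow> 'd model \<Rightarrow> (nat \<Rightarrow> real) \<Rightarrow>
    ((real^'d) set \<Rightarrow> real) \<Rightarrow> ((real^'d) set \<Rightarrow> real) \<Rightarrow> nat \<Rightarrow>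
    (nat \<Rightarrow> (real^'d) udof \<Rightarrow> real^'d) \<Rightarrow> ((real^'d) set \<Rightarrow> real^'d) \<Rightarrow> bool" where
  "contact_eq D P t \<beta>n \<beta>\<tau> n u l \<longleftrightarrow> (\<forall>\<sigma>\<in>frac_faces D.
     normal_part D \<sigma> (l \<sigma>) =
       max 0 (normal_part D \<sigma> (l \<sigma>) + \<beta>n \<sigma> * normal_part D \<sigma> (jump D (u n) \<sigma>)) \<and>
     tangent_part D \<sigma> (l \<sigma>) =
       closest_point (cball 0 (fric P \<sigma> * normal_part D \<sigma> (l \<sigma>)))
         (tangent_part D \<sigma> (l \<sigma>) + \<beta>\<tau> \<sigma> *\<^sub>R tangent_part D \<sigma> (jump D (dt_fam t u n) \<sigma>)))"

definition coupling_laws :: "(real^'d) disc \<Rightarrow> 'd model \<Rightarrow> (nat \<Rightarrow> real) \<Rightarrow> nat \<Rightarrow>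
    (nat \<Rightarrow> ((real^'d) mdof \<Rightarrow> real) \<times> ((real^'d) fdof \<Rightarrow> real)) \<Rightarrow>
    (nat \<Rightarrow> (real^'d) udof \<Rightarrow> real^'d) \<Rightarrow>
    (nat \<Rightarrow> (real^'d) set \<Rightarrow> real) \<Rightarrow> (nat \<Rightarrow> (real^'d) set \<Rightarrow> real) \<Rightarrow> bool" where
  "coupling_laws D P t N p u \<phi> df \<longleftrightarrow>
     (\<forall>n\<in>{1..N}. \<forall>K\<in>cells D. dt_fam t \<phi> n K =
        biot_b P * dvg D (dt_fam t u n) K
        + (1 / biot_M P) * dt_fam t (\<lambda>m. fst (p m)) n (PCell K)) \<and>
     (\<forall>n\<le>N. \<forall>\<sigma>\<in>frac_faces D. df n \<sigma> = d_c P \<sigma> - normal_part D \<sigma> (jump D (u n) \<sigma>))"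

end

theory Submission
  imports Defs
begin

text \<open>
  Test the flow equation with \<open>p\<^sup>n\<close> and the mechanical equation with \<open>\<delta>\<^sub>tu\<close>, and add. The coupling
  laws cancel the products of pressures with divergences and with normal jumps. The elastic,
  stabilisation and compressibility terms have the form \<open>B(w\<^sup>n, \<delta>\<^sub>tw)\<close> with \<open>B\<close> symmetric and
  nonnegative, which dominates \<open>\<delta>\<^sub>t(B(w, w) / 2)\<close>. The tangential contact condition gives
  \<open>\<lambda>\<^sub>\<tau> \<bullet> \<lbrakk>\<delta>\<^sub>tu\<rbrakk>\<^sub>\<tau> \<ge> F \<lambda>\<^sub>n |\<lbrakk>\<delta>\<^sub>tu\<rbrakk>\<^sub>\<tau>|\<close>, and the normal one gives
  \<open>\<lambda>\<^sub>n \<lbrakk>\<delta>\<^sub>tu\<rbrakk>\<^sub>n \<ge> 0\<close> because \<open>\<lambda>\<^sub>n\<close> vanishes where \<open>\<lbrakk>u\<^sup>n\<rbrakk>\<^sub>n < 0\<close> and the previous normal jump is nonpositive.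
\<close>

section \<open>Piecewise constant functions\<close>

text \<open>Common form of \<open>cellwise\<close> and \<open>facewise\<close>, so that
  measurability and integration are treated once for both.\<close>

definition piecewise :: "'a set set \<Rightarrow> ('a set \<Rightarrow> 'b::real_vector) \<Rightarrow> 'a \<Rightarrow> 'b" where
  "piecewise A \<phi> x = (\<Sum>S\<in>A. if x \<in> S then \<phi> S else 0)"

lemma cellwise_eq_piecewise: "cellwise D = piecewise (cells D)"
  by (simp add: fun_eq_iff cellwise_def piecewise_def)

lemma facewise_eq_piecewise: "facewise D = piecewise (frac_faces D)"
  by (simp add: fun_eq_iff facewise_def piecewise_def)

lemma piecewise_eq:
  assumes "finite A" "disjoint A" "S \<in> A" "x \<in> S"
  shows "piecewise A \<phi> x = \<phi> S"
proof -
  have "x \<in> T \<longleftrightarrow> T = S" if "T \<in> A" for T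
    using assms that by (auto simp: disjoint_def)
  then have "piecewise A \<phi> x = (\<Sum>T\<in>A. if T = S then \<phi> T else 0)"
    unfolding piecewise_def by (intro sum.cong) auto
  then show ?thesis
    using assms by simp
qed

lemma piecewise_outside: "x \<notin> \<Union>A \<Longrightarrow> piecewise A \<phi> x = 0"
  unfolding piecewise_def by (intro sum.neutral) auto

text \<open>Serves to collapse a product of piecewise constant functions into a single one. The
  equality holds everywhere, not just almost everywhere, because such products also vanish off the
  union.\<close>

lemma piecewise_eqI:
  assumes "finite A" "disjoint A" "\<And>S x. S \<in> A \<Longrightarrow> x \<in> S \<Longrightarrow> w x = \<phi> S"
    and "\<And>x. x \<notin> \<Union>A \<Longrightarrow> w x = 0"
  shows "w = piecewise A \<phi>"
proof
  fix x
  show "w x = piecewise A \<phi> x"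
  proof (cases "x \<in> \<Union>A")
    case True
    then obtain S where "S \<in> A" "x \<in> S" by blast
    with assms show ?thesis
      by (simp add: piecewise_eq)
  next
    case False
    with assms(4) show ?thesis
      by (simp add: piecewise_outside)
  qed
qed

lemma piecewise_measurable [measurable]:
  fixes \<phi> :: "'a::euclidean_space set \<Rightarrow> 'b::euclidean_space"
  assumes "\<And>S. S \<in> A \<Longrightarrow> S \<in> sets borel"
  shows "piecewise A \<phi> \<in> borel_measurable borel"
  unfolding piecewise_def using assms
  by (intro borel_measurable_sum measurable_If_set) auto

text \<open>The defining sum is integrated term by term: each \<open>S \<inter> B\<close> is Borel
  and has finite measure because \<open>S\<close> is bounded.\<close>

lemma
  fixes \<phi> :: "'a::euclidean_space set \<Rightarrow> real"
  assumes "\<And>S. S \<in> A \<Longrightarrow> S \<in> sets borel" "\<And>S. S \<in> A \<Longrightarrow> bounded S" "B \<in> sets borel"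
  shows set_integrable_piecewise: "set_integrable lborel B (piecewise A \<phi>)"
    and set_integral_piecewise:
      "(LINT x:B|lborel. piecewise A \<phi> x) = (\<Sum>S\<in>A. measure lborel (S \<inter> B) * \<phi> S)"
proof -
  have eq: "indicat_real B x *\<^sub>R piecewise A \<phi> x = (\<Sum>S\<in>A. indicat_real (S \<inter> B) x *\<^sub>R \<phi> S)" for x
    unfolding piecewise_def by (auto simp: sum_distrib_left indicator_def intro!: sum.cong)
  have *: "S \<inter> B \<in> sets lborel \<and> emeasure lborel (S \<inter> B) < \<infinity>" if "S \<in> A" for S
    using assms that by (auto intro!: emeasure_bounded_finite bounded_Int simp del: infinity_ennreal_def)
  have int: "integrable lborel (\<lambda>x. indicat_real (S \<inter> B) x *\<^sub>R \<phi> S)" if "S \<in> A" for S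
    using *[OF that] by (intro integrable_scaleR_left integrable_real_indicator) auto
  show "set_integrable lborel B (piecewise A \<phi>)"
    unfolding set_integrable_def eq using int by (intro Bochner_Integration.integrable_sum) auto
  show "(LINT x:B|lborel. piecewise A \<phi> x) = (\<Sum>S\<in>A. measure lborel (S \<inter> B) * \<phi> S)"
    unfolding set_lebesgue_integral_def eq using int *
    by (subst Bochner_Integration.integral_sum) (auto simp: Int_commute)
qed

section \<open>Polytopal sets and their surface measure\<close>

lemma polytopal_bounded:
  assumes "polytopal k S"
  shows "bounded S"
proof -
  from assms obtain H P where P: "finite P" "\<forall>C\<in>P. polytope C" and S: "S = top_of_set H interior_of \<Union>P"
    unfolding polytopal_def by blast
  have "bounded (\<Union>P)"
    using P by (auto simp: bounded_Union polytope_imp_bounded)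
  then show ?thesis
    unfolding S by (rule bounded_subset) (rule interior_of_subset)
qed

lemma polytopal_affine:
  assumes "polytopal k S"
  obtains H where "affine H" "aff_dim H = k" "S \<subseteq> H" "openin (top_of_set H) S"
proof -
  from assms obtain H P where H: "affine H" "aff_dim H = k" and S: "S = top_of_set H interior_of \<Union>P"
    unfolding polytopal_def by blast
  have o: "openin (top_of_set H) S"
    unfolding S by simp
  then have "S \<subseteq> H"
    by (rule openin_imp_subset)
  with H o that show ?thesis by blast
qed

text \<open>A relatively open subset of \<open>H\<close> is the trace of an open set on
  \<open>H\<close>, and affine sets are closed.\<close>

lemma polytopal_borel:
  assumes "polytopal k S"
  shows "S \<in> sets borel"
proof -
  obtain H where H: "affine H" "openin (top_of_set H) S"
    using polytopal_affine[OF assms] by metis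
  then obtain U where "open U" "S = H \<inter> U"
    by (auto simp: openin_open)
  then show ?thesis
    using affine_closed[OF H(1)] by auto
qed

text \<open>\<open>plane_normal\<close> is a choice, so a witness has to be found: a set of
  codimension one lies in a hyperplane, and the normal of that hyperplane, scaled to length one,
  qualifies.\<close>

lemma plane_normal:
  fixes S :: "'a::euclidean_space set"
  assumes "polytopal (int DIM('a) - 1) S"
  shows "norm (plane_normal S) = 1" "x \<in> S \<Longrightarrow> y \<in> S \<Longrightarrow> plane_normal S \<bullet> (x - y) = 0"
proof -
  obtain H where H: "affine H" "aff_dim H = int DIM('a) - 1" "S \<subseteq> H"
    using polytopal_affine[OF assms] by metis
  then have "aff_dim H = int (DIM('a) - 1)"
    by (simp add: of_nat_diff)
  then obtain a b where a: "a \<noteq> 0" "affine hull H = {x. a \<bullet> x = b}"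
    using aff_dim_eq_hyperplane[of H] H by auto
  then have "norm (a /\<^sub>R norm a) = 1 \<and> (\<forall>x\<in>S. \<forall>y\<in>S. (a /\<^sub>R norm a) \<bullet> (x - y) = 0)"
    using H(3) hull_subset[of H affine] by (auto simp: inner_diff_right)
  then have "norm (plane_normal S) = 1 \<and> (\<forall>x\<in>S. \<forall>y\<in>S. plane_normal S \<bullet> (x - y) = 0)"
    unfolding plane_normal_def by (rule someI)
  then show "norm (plane_normal S) = 1" "x \<in> S \<Longrightarrow> y \<in> S \<Longrightarrow> plane_normal S \<bullet> (x - y) = 0"
    by auto
qed

lemma sets_surf [simp, measurable_cong]: "sets (surf S) = sets borel"
  and space_surf [simp]: "space (surf S) = UNIV"
  by (simp_all add: surf_def Let_def)

text \<open>\<open>surf S\<close> is the image of Lebesgue measure on the prism \<open>Q\<close> of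
  height one under the projection \<open>\<pi>\<close>. The prism over a bounded set is bounded,
  hence the finite mass, and \<open>\<pi>\<close> maps \<open>Q\<close> into
  \<open>S\<close>.\<close>

lemma
  fixes S :: "'a::euclidean_space set"
  assumes S: "polytopal (int DIM('a) - 1) S"
  shows finite_measure_surf: "finite_measure (surf S)"
    and AE_surf: "AE x in surf S. x \<in> S"
proof -
  define n where "n = plane_normal S"
  define x0 where "x0 = (SOME x. x \<in> S)"
  define Q where "Q = {x + r *\<^sub>R n |x r. x \<in> S \<and> 0 \<le> r \<and> r \<le> 1}"
  define \<pi> where "\<pi> z = z - ((z - x0) \<bullet> n) *\<^sub>R n" for z
  have surf: "surf S = distr (restrict_space lborel Q) borel \<pi>"
    unfolding surf_def Let_def n_def x0_def Q_def \<pi>_def ..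
  have n: "n \<bullet> n = 1" "\<And>x y. x \<in> S \<Longrightarrow> y \<in> S \<Longrightarrow> n \<bullet> (x - y) = 0"
    using plane_normal[OF S] by (simp_all add: n_def norm_eq_1)
  have "x0 \<in> S"
    using S unfolding x0_def polytopal_def by (auto intro: someI)
  then have \<pi>: "(x + r *\<^sub>R n - x0) \<bullet> n = r" "\<pi> (x + r *\<^sub>R n) = x" if "x \<in> S" for x r
    using n(1) n(2)[OF that] by (simp_all add: \<pi>_def inner_commute inner_simps)
  \<comment> \<open>The definition of \<open>Q\<close> as an image does not show measurability.
    Height and foot point are recovered from \<open>z\<close> by Borel maps, which exhibits
    \<open>Q\<close> as a preimage of Borel sets.\<close>
  have Q: "Q = {z. \<pi> z \<in> S \<and> 0 \<le> (z - x0) \<bullet> n \<and> (z - x0) \<bullet> n \<le> 1}"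
  proof (intro set_eqI iffI)
    fix z assume "z \<in> {z. \<pi> z \<in> S \<and> 0 \<le> (z - x0) \<bullet> n \<and> (z - x0) \<bullet> n \<le> 1}"
    moreover have "z = \<pi> z + ((z - x0) \<bullet> n) *\<^sub>R n"
      by (simp add: \<pi>_def)
    ultimately show "z \<in> Q"
      unfolding Q_def by blast
  qed (auto simp: Q_def \<pi>)
  have [measurable]: "\<pi> \<in> borel_measurable borel"
    unfolding \<pi>_def by measurable
  have [measurable]: "S \<in> sets borel"
    by (rule polytopal_borel[OF S])
  have Q_sets [measurable]: "Q \<in> sets borel"
    unfolding Q by measurable
  obtain B where B: "\<And>x. x \<in> S \<Longrightarrow> norm x \<le> B"
    using polytopal_bounded[OF S] unfolding bounded_iff by blast
  have "norm z \<le> B + 1" if "z \<in> Q" for z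
  proof -
    from that obtain x r where z: "z = x + r *\<^sub>R n" "x \<in> S" "0 \<le> r" "r \<le> 1"
      unfolding Q_def by blast
    then show ?thesis
      using B[of x] norm_triangle_ineq[of x "r *\<^sub>R n"] plane_normal(1)[OF S] by (simp add: n_def)
  qed
  then have "bounded Q"
    unfolding bounded_iff by blast
  then have "emeasure lborel Q < \<infinity>"
    by (rule emeasure_bounded_finite)
  then have "finite_measure (restrict_space lborel Q)"
    by (intro finite_measureI) (simp add: emeasure_restrict_space space_restrict_space)
  moreover have \<pi>_meas: "\<pi> \<in> measurable (restrict_space lborel Q) borel"
    by (intro measurable_restrict_space1) simp
  ultimately show "finite_measure (surf S)"
    unfolding surf by (intro finite_measure.finite_measure_distr)
  show "AE x in surf S. x \<in> S"
    unfolding surf by (subst AE_distr_iff[OF \<pi>_meas]) (auto simp: AE_restrict_space_iff Q)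
qed

lemma integrable_surf_id:
  fixes S :: "'a::euclidean_space set"
  assumes S: "polytopal (int DIM('a) - 1) S"
  shows "integrable (surf S) (\<lambda>x. x)"
proof -
  interpret finite_measure "surf S"
    by (rule finite_measure_surf[OF S])
  obtain B where "\<And>x. x \<in> S \<Longrightarrow> norm x \<le> B"
    using polytopal_bounded[OF S] unfolding bounded_iff by blast
  then show ?thesis
    using AE_surf[OF S] by (intro integrable_const_bound[of _ B]) auto
qed

text \<open>\<open>face_Pi\<close> is affine in the position. Its integrability is what lets the
  face average in \<open>jump\<close> be split linearly.\<close>

lemma integrable_surf_affine:
  fixes S :: "(real^'d) set" and A :: "real^'d^'d"
  assumes S: "polytopal (int CARD('d) - 1) S"
  shows "integrable (surf S) (\<lambda>x. A *v (x - c) + m)"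
proof -
  have S': "polytopal (int DIM(real^'d) - 1) S"
    using S by simp
  interpret finite_measure "surf S"
    by (rule finite_measure_surf[OF S'])
  have "bounded_linear ((*v) A)"
    by (simp add: linear_conv_bounded_linear[symmetric] matrix_vector_mul_linear)
  then have "integrable (surf S) (\<lambda>x. A *v (x - c))"
    by (rule integrable_bounded_linear) (intro Bochner_Integration.integrable_diff integrable_surf_id[OF S'] integrable_const)
  then show ?thesis
    by (intro Bochner_Integration.integrable_add integrable_const)
qed

text \<open>\<open>surf S\<close> lives on \<open>S\<close>, and by disjointness no other member of
  \<open>A\<close> contributes there, so the function is almost everywhere the constant
  \<open>\<phi> S\<close>.\<close>

lemma
  fixes \<phi> :: "'a::euclidean_space set \<Rightarrow> 'b::euclidean_space"
  assumes A: "finite A" "disjoint A" "\<And>T. T \<in> A \<Longrightarrow> T \<in> sets borel"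
    and S: "S \<in> A" "polytopal (int DIM('a) - 1) S"
  shows AE_surf_piecewise: "AE x in surf S. piecewise A \<phi> x = \<phi> S"
    and integrable_surf_piecewise: "integrable (surf S) (piecewise A \<phi>)"
    and integral_surf_piecewise: "(LINT x|surf S. piecewise A \<phi> x) = area S *\<^sub>R \<phi> S"
proof -
  interpret finite_measure "surf S"
    by (rule finite_measure_surf[OF S(2)])
  show AE: "AE x in surf S. piecewise A \<phi> x = \<phi> S"
    using AE_surf[OF S(2)] by eventually_elim (use A S in \<open>auto intro: piecewise_eq\<close>)
  have m: "piecewise A \<phi> \<in> borel_measurable (surf S)"
    using A by measurable
  show "integrable (surf S) (piecewise A \<phi>)"
    using AE m by (subst integrable_cong_AE[where g = "\<lambda>_. \<phi> S"]) auto
  show "(LINT x|surf S. piecewise A \<phi> x) = area S *\<^sub>R \<phi> S"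
    using AE m by (subst integral_cong_AE[where g = "\<lambda>_. \<phi> S"]) (auto simp: area_def)
qed

section \<open>Discrete time derivative\<close>

lemma linear_dt: "linear f \<Longrightarrow> f (dt t w n) = dt t (\<lambda>m. f (w m)) n"
  by (simp add: dt_def linear_cmul linear_diff)

lemma dt_add: "dt t (\<lambda>m. v m + w m) n = dt t v n + dt t w n"
  by (simp add: dt_def algebra_simps)

lemma dt_diff: "dt t (\<lambda>m. v m - w m) n = dt t v n - dt t w n"
  by (simp add: dt_def algebra_simps)

lemma dt_sum: "dt t (\<lambda>m. \<Sum>i\<in>I. w m i) n = (\<Sum>i\<in>I. dt t (\<lambda>m. w m i) n)"
  by (simp add: dt_def sum_subtractf scaleR_sum_right[symmetric])

lemma dt_scaleR: "dt t (\<lambda>m. c *\<^sub>R w m) n = c *\<^sub>R dt t w n"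
  by (simp add: dt_def algebra_simps)

lemma dt_mult: "dt t (\<lambda>m. (c::real) * w m) n = c * dt t w n"
  using dt_scaleR[of t c w n] by simp

text \<open>Discrete chain rule for an implicit Euler step. Expanding
  \<open>B (x - y) (x - y) \<ge> 0\<close> at the new value \<open>x\<close> and the old value
  \<open>y\<close> gives it before division by the time step; the discarded square is the numerical
  dissipation.\<close>

lemma dt_half_bilinear_le:
  assumes "bilinear B" "\<And>x y. B x y = B y x" "\<And>x. (0::real) \<le> B x x" "t (n - 1) < t n"
  shows "dt t (\<lambda>m. 1/2 * B (w m) (w m)) n \<le> B (w n) (dt t w n)"
proof -
  let ?x = "w n" and ?y = "w (n - 1)"
  have "0 \<le> B (?x - ?y) (?x - ?y)"
    by (rule assms)
  also have "\<dots> = B ?x ?x - 2 * B ?x ?y + B ?y ?y"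
    using assms(2)[of ?x ?y] by (simp add: bilinear_lsub[OF assms(1)] bilinear_rsub[OF assms(1)])
  finally have "1/2 * B ?x ?x - 1/2 * B ?y ?y \<le> B ?x (?x - ?y)"
    by (simp add: bilinear_rsub[OF assms(1)])
  then show ?thesis
    using assms(4) by (simp only: dt_def bilinear_rmul[OF assms(1)]) (intro scaleR_left_mono, auto)
qed

lemma dt_half_inner_le:
  "t (n - 1) < t n \<Longrightarrow> dt t (\<lambda>m. 1/2 * (w m \<bullet> w m)) n \<le> w n \<bullet> dt t w n"
  by (intro dt_half_bilinear_le[where B = "(\<bullet>)"])
     (auto simp: inner_commute bilinear_def linear_iff inner_simps)

section \<open>Linearity of the displacement reconstructions\<close>

lemma linear_tensor: "linear (\<lambda>a. a \<otimes>\<^sub>t b)"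
  by (intro linearI) (simp_all add: tensor_def vec_eq_iff algebra_simps)

lemma linear_transpose: "linear (transpose :: real^'n^'m \<Rightarrow> _)"
  by (intro linearI) (simp_all add: transpose_def vec_eq_iff)

lemma linear_trace: "linear (trace :: real^'n^'n \<Rightarrow> real)"
  by (intro linearI) (simp_all add: trace_def sum.distrib sum_distrib_left)

lemma linear_matrix_vector_left: "linear (\<lambda>A :: real^'n^'m. A *v x)"
  by (intro linearI) (simp_all add: matrix_vector_mult_add_rdistrib scaleR_matrix_vector_assoc)

text \<open>\<open>dt_fam\<close> differences the unknowns one by one, \<open>dt\<close> the
  reconstructed values. Each reconstruction is linear in the unknowns, so the two commute; the
  following lemmas climb from nodal values to means, gradients, strains and jumps.\<close>

lemma node_val_dt_fam: "node_val D (dt_fam t u n) K s = dt t (\<lambda>m. node_val D (u m) K s) n"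
  by (simp add: node_val_def dt_fam_def)

lemma face_mean_dt_fam: "face_mean D (dt_fam t u n) K \<sigma> = dt t (\<lambda>m. face_mean D (u m) K \<sigma>) n"
  by (simp add: face_mean_def node_val_dt_fam dt_sum dt_scaleR)

lemma cell_mean_dt_fam: "cell_mean D (dt_fam t u n) K = dt t (\<lambda>m. cell_mean D (u m) K) n"
  by (simp add: cell_mean_def node_val_dt_fam dt_sum dt_scaleR)

lemma face_grad_dt_fam: "face_grad D (dt_fam t u n) K \<sigma> = dt t (\<lambda>m. face_grad D (u m) K \<sigma>) n"
  by (simp add: face_grad_def node_val_dt_fam dt_sum[symmetric] dt_scaleR[symmetric]
      linear_dt[OF linear_tensor])

lemma cell_grad_dt_fam: "cell_grad D (dt_fam t u n) K = dt t (\<lambda>m. cell_grad D (u m) K) n"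
  by (simp add: cell_grad_def face_mean_dt_fam dt_fam_def dt_sum dt_scaleR dt_add linear_dt[OF linear_tensor])

lemma face_Pi_dt_fam: "face_Pi D (dt_fam t u n) K \<sigma> x = dt t (\<lambda>m. face_Pi D (u m) K \<sigma> x) n"
  by (simp add: face_Pi_def face_grad_dt_fam face_mean_dt_fam dt_add linear_dt[OF linear_matrix_vector_left])

lemma cell_Pi_dt_fam: "cell_Pi D (dt_fam t u n) K x = dt t (\<lambda>m. cell_Pi D (u m) K x) n"
  by (simp add: cell_Pi_def cell_grad_dt_fam cell_mean_dt_fam dt_add linear_dt[OF linear_matrix_vector_left])

lemma strain_dt_fam: "strain D (dt_fam t u n) K = dt t (\<lambda>m. strain D (u m) K) n"
  by (simp add: strain_def cell_grad_dt_fam dt_add dt_scaleR linear_dt[OF linear_transpose])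

lemma jump_dt_fam:
  fixes D :: "(real^'d) disc"
  assumes "polytopal (int CARD('d) - 1) \<sigma>"
  shows "jump D (dt_fam t u n) \<sigma> = dt t (\<lambda>m. jump D (u m) \<sigma>) n"
proof -
  have int: "integrable (surf \<sigma>) (\<lambda>x. face_Pi D (u m) K \<sigma> x)" for m K
    unfolding face_Pi_def by (rule integrable_surf_affine[OF assms])
  then have "dt t (\<lambda>m. LINT x|surf \<sigma>. face_Pi D (u m) K \<sigma> x - face_Pi D (u m) L \<sigma> x) n
    = (LINT x|surf \<sigma>. dt t (\<lambda>m. face_Pi D (u m) K \<sigma> x - face_Pi D (u m) L \<sigma> x) n)" for K L
    by (simp add: dt_def)
  then show ?thesis
    by (simp add: jump_def Let_def face_Pi_dt_fam dt_diff[symmetric] dt_add dt_scaleR dt_fam_def)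
qed

section \<open>Elastic and stabilisation energies\<close>

text \<open>The inner product on matrices is the Frobenius product, so it is the contraction of
  stress with strain, and the trace becomes a product with the identity.\<close>

lemma mat_1_inner: "mat 1 \<bullet> e = trace (e :: real^'n^'n)"
  by (simp add: inner_vec_def mat_def trace_def if_distrib if_distribR cong: if_cong)

lemma stress_inner:
  "stress D P v K \<bullet> e = 2 * mu P K * (strain D v K \<bullet> e) + lam P K * (trace (strain D v K) * trace e)"
  by (simp add: stress_def dvg_def inner_add_left mat_1_inner)

text \<open>Cauchy-Schwarz for the Frobenius product against the identity, whose squared norm is the
  dimension.\<close>

lemma trace_square_le:
  fixes e :: "real^'n^'n"
  shows "(trace e)\<^sup>2 \<le> real CARD('n) * (e \<bullet> e)"
proof -
  have "trace (mat 1 :: real^'n^'n) = real CARD('n)"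
    by (simp add: trace_def mat_def)
  then show ?thesis
    using Cauchy_Schwarz_ineq[of "mat 1" e] by (simp add: mat_1_inner)
qed

text \<open>Only \<open>l < 0\<close> is delicate. There \<open>(trace e)\<^sup>2\<close> is
  replaced by its bound \<open>real CARD('n) * (e \<bullet> e)\<close>, and the second assumption is
  exactly the sign of the resulting coefficient.\<close>

lemma elastic_energy_nonneg:
  fixes e :: "real^'n^'n"
  assumes "0 < \<mu>" "0 < 2 * \<mu> + real CARD('n) * l"
  shows "0 \<le> 2 * \<mu> * (e \<bullet> e) + l * (trace e * trace e)"
proof (cases "0 \<le> l")
  case False
  have "0 \<le> (2 * \<mu> + real CARD('n) * l) * (e \<bullet> e)"
    using assms by simp
  also have "\<dots> = 2 * \<mu> * (e \<bullet> e) + l * (real CARD('n) * (e \<bullet> e))"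
    by (simp add: algebra_simps)
  also have "\<dots> \<le> 2 * \<mu> * (e \<bullet> e) + l * (trace e)\<^sup>2"
    using False by (intro add_left_mono mult_left_mono_neg trace_square_le) auto
  finally show ?thesis
    by (simp add: power2_eq_square)
qed (use assms in simp)

lemma dt_elastic_energy_le:
  fixes D :: "(real^'d) disc"
  assumes "0 < mu P K" "0 < 2 * mu P K + real CARD('d) * lam P K" "t (n - 1) < t n"
  shows "dt t (\<lambda>m. 1/2 * (stress D P (u m) K \<bullet> strain D (u m) K)) n
    \<le> stress D P (u n) K \<bullet> strain D (dt_fam t u n) K"
  unfolding stress_inner strain_dt_fam
proof (rule dt_half_bilinear_le)
  show "bilinear (\<lambda>e e'. 2 * mu P K * (e \<bullet> e') + lam P K * (trace e * trace e'))"
    by (simp add: bilinear_def linear_iff linear_add[OF linear_trace] linear_cmul[OF linear_trace]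
        inner_simps algebra_simps)
qed (use assms in \<open>simp_all add: elastic_energy_nonneg inner_commute\<close>)

text \<open>On each cell the stabilisation is a sum, with nonnegative factors, of inner products of
  quantities linear in the unknowns, namely nodal residuals and bubbles; the discrete chain rule
  applies to each. Boundedness of \<open>K\<close> gives a nonnegative diameter.\<close>

lemma stab_dt_le:
  fixes D :: "(real^'d) disc"
  assumes "\<And>K. K \<in> cells D \<Longrightarrow> bounded K \<and> 0 \<le> 2 * mu P K + lam P K" "t (n - 1) < t n"
  shows "dt t (\<lambda>m. 1/2 * stab D P (u m) (u m)) n \<le> stab D P (u n) (dt_fam t u n)"
proof -
  have "dt t (\<lambda>m. 1/2 * stab_cell D K (u m) (u m)) n \<le> stab_cell D K (u n) (dt_fam t u n)"
    if K: "bounded K" for K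
  proof -
    define w where "w s m = node_val D (u m) K s - cell_Pi D (u m) K s" for s m
    have w: "node_val D (dt_fam t u n) K s - cell_Pi D (dt_fam t u n) K s = dt t (w s) n" for s
      by (simp add: w_def[abs_def] node_val_dt_fam cell_Pi_dt_fam dt_diff)
    have "(\<lambda>m. 1/2 * stab_cell D K (u m) (u m))
      = (\<lambda>m. diameter K ^ (CARD('d) - 2) * (\<Sum>s\<in>nodes_of D K. 1/2 * (w s m \<bullet> w s m))
      + diameter K ^ (CARD('d) - 2) * (\<Sum>\<sigma>\<in>plus_faces D K.
          1/2 * (u m (UBubble K \<sigma>) \<bullet> u m (UBubble K \<sigma>))))"
      by (simp add: stab_cell_def w_def sum_divide_distrib[symmetric] add_divide_distrib)
    then have "dt t (\<lambda>m. 1/2 * stab_cell D K (u m) (u m)) n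
      = diameter K ^ (CARD('d) - 2) * (\<Sum>s\<in>nodes_of D K. dt t (\<lambda>m. 1/2 * (w s m \<bullet> w s m)) n)
      + diameter K ^ (CARD('d) - 2) * (\<Sum>\<sigma>\<in>plus_faces D K.
          dt t (\<lambda>m. 1/2 * (u m (UBubble K \<sigma>) \<bullet> u m (UBubble K \<sigma>))) n)"
      by (simp only: dt_mult dt_add dt_sum)
    also have "\<dots> \<le> stab_cell D K (u n) (dt_fam t u n)"
      unfolding stab_cell_def w w_def[symmetric] dt_fam_def using diameter_ge_0[OF K]
      by (intro add_mono mult_left_mono sum_mono dt_half_inner_le assms) auto
    finally show ?thesis .
  qed
  then have "(\<Sum>K\<in>cells D. (2 * mu P K + lam P K) * dt t (\<lambda>m. 1/2 * stab_cell D K (u m) (u m)) n)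
    \<le> stab D P (u n) (dt_fam t u n)"
    unfolding stab_def using assms(1) by (intro sum_mono mult_left_mono) auto
  moreover have "(\<lambda>m. 1/2 * stab D P (u m) (u m))
    = (\<lambda>m. \<Sum>K\<in>cells D. (2 * mu P K + lam P K) * (1/2 * stab_cell D K (u m) (u m)))"
    by (simp add: stab_def sum_divide_distrib)
  ultimately show ?thesis
    by (simp only: dt_sum dt_mult)
qed

section \<open>Contact conditions\<close>

text \<open>The equation leaves two cases: \<open>x = 0\<close> with
  \<open>\<beta> * y \<le> 0\<close>, or \<open>x > 0\<close> with \<open>\<beta> * y = 0\<close>.
  Positivity of \<open>\<beta>\<close> transfers both to \<open>y\<close>.\<close>

lemma complementarity:
  assumes "0 < \<beta>" "(x::real) = max 0 (x + \<beta> * y)"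
  shows "0 \<le> x" "y \<le> 0" "x * y = 0"
proof -
  show "0 \<le> x"
    using assms(2) by linarith
  have "\<beta> * y \<le> 0"
    using assms(2) by linarith
  then show "y \<le> 0"
    using assms(1) by (simp add: mult_le_0_iff)
  have "x = 0 \<or> \<beta> * y = 0"
    using assms(2) by linarith
  then show "x * y = 0"
    using assms(1) by auto
qed

text \<open>As the normal has length one, the power splits into a normal part, nonnegative by
  assumption, and a tangential part. The latter is bounded through the variational inequality of the
  projection onto the ball, whose residual is \<open>\<beta> *\<^sub>R ?w\<close>.\<close>

lemma contact_power_ge:
  fixes D :: "(real^'d) disc"
  assumes "norm (normal_plus D \<sigma>) = 1" "0 < \<beta>" "0 \<le> r"
    and normal: "0 \<le> normal_part D \<sigma> m * normal_part D \<sigma> w"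
    and tangent: "tangent_part D \<sigma> m
      = closest_point (cball 0 r) (tangent_part D \<sigma> m + \<beta> *\<^sub>R tangent_part D \<sigma> w)"
  shows "r * norm (tangent_part D \<sigma> w) \<le> m \<bullet> w"
proof -
  let ?n = "normal_plus D \<sigma>" and ?m = "tangent_part D \<sigma> m" and ?w = "tangent_part D \<sigma> w"
  have n: "?n \<bullet> ?n = 1"
    using assms by (simp add: norm_eq_1)
  have "m \<bullet> w = normal_part D \<sigma> m * normal_part D \<sigma> w + ?m \<bullet> ?w"
    by (simp add: tangent_part_def normal_part_def inner_simps n inner_commute algebra_simps)
  moreover have "r * norm ?w \<le> ?m \<bullet> ?w"
  proof (cases "?w = 0")
    case False
    \<comment> \<open>Among the points of the ball this one has the largest inner product with
      \<open>?w\<close>. It needs a direction, hence the separate case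
      \<open>?w = 0\<close>.\<close>
    define y where "y = (r / norm ?w) *\<^sub>R ?w"
    have "y \<in> cball 0 r"
      using False assms by (simp add: y_def)
    then have "(?m + \<beta> *\<^sub>R ?w - ?m) \<bullet> (y - ?m) \<le> 0"
      using closest_point_dot[of "cball 0 r" y "?m + \<beta> *\<^sub>R ?w"] tangent by simp
    then have "?w \<bullet> y \<le> ?m \<bullet> ?w"
      using assms(2) by (simp add: inner_diff_right inner_commute mult_le_0_iff)
    moreover have "?w \<bullet> y = r * norm ?w"
      using False by (simp add: y_def dot_square_norm power2_eq_square)
    ultimately show ?thesis by simp
  qed simp
  ultimately show ?thesis
    using normal by simp
qed

section \<open>Reduction of integrals to sums, and splitting of integrals\<close>

text \<open>The weight of a cell is kept as the measure of \<open>K \<inter> omega D\<close>, so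
  that the inclusion of cells in the domain need not be derived. The elastic, Biot and accumulation
  sums below all carry this weight, of which only nonnegativity is used.\<close>

lemma int_omega_cellwise:
  fixes \<phi> :: "(real^'d) set \<Rightarrow> real"
  assumes "polytopal_mesh D"
  shows "int_omega D (piecewise (cells D) \<phi>)
    = (\<Sum>K\<in>cells D. measure lborel (K \<inter> omega D) * \<phi> K)"
  unfolding int_omega_def using assms
  by (intro set_integral_piecewise)
     (auto simp: polytopal_mesh_def intro: polytopal_borel polytopal_bounded)

lemma frac_faces_mesh:
  fixes D :: "(real^'d) disc"
  assumes "polytopal_mesh D" "fracture_network D"
  shows "finite (frac_faces D)" "disjoint (frac_faces D)"
    "\<And>\<sigma>. \<sigma> \<in> frac_faces D \<Longrightarrow> polytopal (int CARD('d) - 1) \<sigma>"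
proof -
  have sub: "frac_faces D \<subseteq> faces D"
    using assms(2) unfolding fracture_network_def by (elim conjE) blast
  have faces: "finite (faces D) \<and> disjoint (faces D) \<and> (\<forall>\<sigma>\<in>faces D. polytopal (int CARD('d) - 1) \<sigma>)"
    using assms(1) unfolding polytopal_mesh_def by (elim conjE) (intro conjI)
  show "finite (frac_faces D)"
    by (rule finite_subset[OF sub faces[THEN conjunct1]])
  show "disjoint (frac_faces D)"
    by (rule pairwise_subset[OF faces[THEN conjunct2, THEN conjunct1] sub])
  show "polytopal (int CARD('d) - 1) \<sigma>" if "\<sigma> \<in> frac_faces D" for \<sigma>
    using faces sub that by blast
qed

lemma int_gamma_facewise:
  fixes \<phi> :: "(real^'d) set \<Rightarrow> real"
  assumes "polytopal_mesh D" "fracture_network D"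
  shows "int_gamma D (piecewise (frac_faces D) \<phi>) = (\<Sum>\<sigma>\<in>frac_faces D. area \<sigma> * \<phi> \<sigma>)"
  unfolding int_gamma_def
proof (intro sum.cong refl)
  fix \<sigma> assume "\<sigma> \<in> frac_faces D"
  then show "(LINT x|surf \<sigma>. piecewise (frac_faces D) \<phi> x) = area \<sigma> * \<phi> \<sigma>"
    using integral_surf_piecewise[of "frac_faces D" \<sigma> \<phi>] frac_faces_mesh[OF assms]
    by (simp add: polytopal_borel[OF frac_faces_mesh(3)[OF assms]])
qed

text \<open>Needed to split the accumulation term from the diffusion term in the flow equation. On
  each \<open>S\<close> the integrand is dominated, up to the factor \<open>c\<close>, by the
  operator norm of \<open>\<kappa> S\<close> times the squared norm of \<open>g\<close>.\<close>

lemma set_integrable_piecewise_quadratic: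
  fixes g :: "real^'d \<Rightarrow> real^'d" and \<kappa> :: "(real^'d) set \<Rightarrow> real^'d^'d"
  assumes A: "\<And>S. S \<in> A \<Longrightarrow> S \<in> sets borel"
    and g: "set_borel_measurable lborel B g" "set_integrable lborel B (\<lambda>x. (norm (g x))\<^sup>2)"
  shows "set_integrable lborel B (\<lambda>x. (c *\<^sub>R (piecewise A \<kappa> x *v g x)) \<bullet> g x)"
proof -
  \<comment> \<open>The hypotheses say nothing about \<open>g\<close> off \<open>B\<close>, hence
    the extension by zero.\<close>
  define G where "G x = indicat_real B x *\<^sub>R g x" for x
  have G: "G \<in> borel_measurable lborel"
    using g(1) unfolding set_borel_measurable_def G_def .
  have "integrable lborel (\<lambda>x. (norm (G x))\<^sup>2)"
    using g(2) unfolding set_integrable_def G_def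
    by (rule Bochner_Integration.integrable_cong[THEN iffD1, rotated 2]) (auto simp: indicator_def)
  then have int: "integrable lborel (\<lambda>x. C * (norm (G x))\<^sup>2)" for C
    by (rule integrable_mult_right)
  have bl: "bounded_linear ((*v) M)" for M :: "real^'d^'d"
    by (simp add: linear_conv_bounded_linear[symmetric] matrix_vector_mul_linear)
  have meas: "(\<lambda>x. M *v G x) \<in> borel_measurable lborel" for M :: "real^'d^'d"
    by (rule measurable_compose[OF G borel_measurable_continuous_onI])
       (rule linear_continuous_on[OF bl])
  have *: "integrable lborel (\<lambda>x. indicat_real S x *\<^sub>R (c * ((\<kappa> S *v G x) \<bullet> G x)))" if "S \<in> A" for S
  proof (rule integrable_mult_indicator)
    show "integrable lborel (\<lambda>x. c * ((\<kappa> S *v G x) \<bullet> G x))"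
    proof (rule Bochner_Integration.integrable_bound[OF int[of "\<bar>c\<bar> * onorm ((*v) (\<kappa> S))"]], goal_cases)
      case 1
      then show ?case
        using G meas by measurable
    next
      case 2
      have "\<bar>(\<kappa> S *v y) \<bullet> y\<bar> \<le> onorm ((*v) (\<kappa> S)) * (norm y)\<^sup>2" for y
        using order_trans[OF Cauchy_Schwarz_ineq2 mult_right_mono[OF onorm[OF bl] norm_ge_zero]]
        by (simp add: power2_eq_square mult.assoc)
      then show ?case
        by (auto simp: abs_mult mult.assoc onorm_pos_le[OF bl] intro!: mult_left_mono)
    qed
  qed (use A that in auto)
  have "piecewise A \<kappa> x *v y = (\<Sum>S\<in>A. indicat_real S x *\<^sub>R (\<kappa> S *v y))" for x y
    unfolding piecewise_def
    by (subst linear_sum[OF linear_matrix_vector_left]) (auto intro!: sum.cong simp: indicator_def)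
  \<comment> \<open>An indicator is idempotent, so the single factor for \<open>B\<close> can be
    absorbed into both occurrences of \<open>g\<close>.\<close>
  then have "indicat_real B x *\<^sub>R ((c *\<^sub>R (piecewise A \<kappa> x *v g x)) \<bullet> g x)
    = (\<Sum>S\<in>A. indicat_real S x *\<^sub>R (c * ((\<kappa> S *v G x) \<bullet> G x)))" for x
    by (auto simp: G_def indicator_def inner_sum_left sum_distrib_left algebra_simps intro!: sum.cong)
  with * show ?thesis
    unfolding set_integrable_def by simp
qed

text \<open>On the face \<open>S\<close> the coefficient is almost everywhere the constant
  \<open>\<kappa> S\<close>, so the quadratic term inherits integrability from
  \<open>(norm (g x))\<^sup>2\<close> and the integral splits.\<close>

lemma integral_surf_add_quadratic:
  fixes g :: "real^'d \<Rightarrow> real^'d" and \<phi> \<kappa> :: "(real^'d) set \<Rightarrow> real"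
  assumes A: "finite A" "disjoint A" "\<And>T. T \<in> A \<Longrightarrow> T \<in> sets borel"
    and S: "S \<in> A" "polytopal (int CARD('d) - 1) S"
    and g: "g \<in> borel_measurable (surf S)" "integrable (surf S) (\<lambda>x. (norm (g x))\<^sup>2)"
  shows "(LINT x|surf S. piecewise A \<phi> x + piecewise A \<kappa> x / c * (norm (g x))\<^sup>2)
    = area S * \<phi> S + (LINT x|surf S. piecewise A \<kappa> x / c * (norm (g x))\<^sup>2)"
proof -
  have S': "polytopal (int DIM(real^'d) - 1) S"
    using S by simp
  have [measurable]: "piecewise A \<kappa> \<in> borel_measurable (surf S)"
    using A by measurable
  have "AE x in surf S. piecewise A \<kappa> x / c * (norm (g x))\<^sup>2 = \<kappa> S / c * (norm (g x))\<^sup>2"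
    by (rule eventually_mono[OF AE_surf_piecewise[OF A S(1) S', of \<kappa>]]) simp_all
  then have "integrable (surf S) (\<lambda>x. piecewise A \<kappa> x / c * (norm (g x))\<^sup>2)"
    using g by (subst integrable_cong_AE[where g = "\<lambda>x. \<kappa> S / c * (norm (g x))\<^sup>2"]) auto
  then show ?thesis
    using integrable_surf_piecewise[OF A S(1) S'] integral_surf_piecewise[OF A S(1) S', of \<phi>]
    by (subst Bochner_Integration.integral_add) auto
qed

section \<open>Energy balances from the tested equations\<close>

text \<open>Makes the discrete velocity an admissible test function for the mechanical equation. At
  the first time step this involves the initial displacement.\<close>

lemma dt_fam_U_D0:
  assumes "u n \<in> U_D0 D" "u (n - 1) \<in> U_D0 D"
  shows "dt_fam t u n \<in> U_D0 D"
  using assms by (auto simp: U_D0_def U_D_def dt_fam_def dt_def)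

lemma time_grid_step:
  assumes "time_grid t N T" "n \<in> {1..N}"
  shows "t (n - 1) < t n"
  using assms by (auto simp: time_grid_def intro!: strict_mono_onD[of "{..N}" t])

text \<open>The flow equation with test function \<open>p n\<close>. The accumulation terms become
  sums, into which the coupling laws can be inserted; the diffusive, exchange and source terms stay
  integrals, the form in which the estimate states them.\<close>

lemma flow_energy_balance:
  fixes D :: "(real^'d) disc"
  assumes mesh: "polytopal_mesh D" "fracture_network D"
    and grads: "hfv_gradients D (perm P)"
    and flow: "flow_eq D P t n p \<phi> df" and p: "p n \<in> X_D0 D"
  shows "(\<Sum>K\<in>cells D. measure lborel (K \<inter> omega D) * (dt_fam t \<phi> n K * fst (p n) (PCell K)))
    + int_omega D (\<lambda>x. ((1 / eta P) *\<^sub>R (cellwise D (perm P) x *v grad_m D (fst (p n)) x))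
        \<bullet> grad_m D (fst (p n)) x)
    + (\<Sum>\<sigma>\<in>frac_faces D. area \<sigma> * (dt_fam t df n \<sigma> * snd (p n) (FFace \<sigma>)))
    + int_gamma D (\<lambda>x. facewise D (conductivity (df (n - 1))) x / eta P * (norm (grad_f D (snd (p n)) x))\<^sup>2)
    + (\<Sum>a\<in>{Plus, Minus}. int_gamma D (\<lambda>x. facewise D (transmissivity P (df (n - 1))) x
        * (pjump D a (p n) x)\<^sup>2))
    = int_omega D (\<lambda>x. h_m P x * Pi_m D (fst (p n)) x) + int_gamma D (\<lambda>x. h_f P x * Pi_f D (snd (p n)) x)"
proof -
  have cells: "finite (cells D)" "disjoint (cells D)" "\<And>K. K \<in> cells D \<Longrightarrow> K \<in> sets borel"
    "\<And>K. K \<in> cells D \<Longrightarrow> bounded K" and omega: "omega D \<in> sets borel"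
    using mesh(1) by (auto simp: polytopal_mesh_def intro: polytopal_borel polytopal_bounded)
  note ff = frac_faces_mesh[OF mesh]
  have ff_borel: "\<And>\<sigma>. \<sigma> \<in> frac_faces D \<Longrightarrow> \<sigma> \<in> sets borel"
    using ff(3) polytopal_borel by blast
  have X: "fst (p n) \<in> X_m D" "snd (p n) \<in> X_f D"
    using p by (auto simp: X_D0_def X_D_def)
  define \<Phi> where "\<Phi> = piecewise (cells D) (\<lambda>K. dt_fam t \<phi> n K * fst (p n) (PCell K))"
  define \<Psi> where "\<Psi> = piecewise (frac_faces D) (\<lambda>\<sigma>. dt_fam t df n \<sigma> * snd (p n) (FFace \<sigma>))"
  let ?Gm = "\<lambda>x. ((1 / eta P) *\<^sub>R (cellwise D (perm P) x *v grad_m D (fst (p n)) x)) \<bullet> grad_m D (fst (p n)) x"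
  let ?Gf = "\<lambda>x. facewise D (conductivity (df (n - 1))) x / eta P * (norm (grad_f D (snd (p n)) x))\<^sup>2"
  have \<Phi>: "(\<lambda>x. cellwise D (dt_fam t \<phi> n) x * Pi_m D (fst (p n)) x) = \<Phi>"
    unfolding \<Phi>_def Pi_m_def cellwise_eq_piecewise using cells
    by (intro piecewise_eqI) (auto simp: piecewise_eq piecewise_outside)
  have \<Psi>: "(\<lambda>x. facewise D (dt_fam t df n) x * Pi_f D (snd (p n)) x) = \<Psi>"
    unfolding \<Psi>_def Pi_f_def facewise_eq_piecewise using ff
    by (intro piecewise_eqI) (auto simp: piecewise_eq piecewise_outside)
  have "set_integrable lborel (omega D) ?Gm"
    unfolding cellwise_eq_piecewise using grads X(1) cells(3)
    by (intro set_integrable_piecewise_quadratic) (auto simp: hfv_gradients_def)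
  moreover have "set_integrable lborel (omega D) \<Phi>"
    unfolding \<Phi>_def using cells omega by (intro set_integrable_piecewise) auto
  ultimately have "int_omega D (\<lambda>x. \<Phi> x + ?Gm x) = int_omega D \<Phi> + int_omega D ?Gm"
    unfolding int_omega_def by (intro set_integral_add)
  then have omega_eq: "int_omega D (\<lambda>x. cellwise D (dt_fam t \<phi> n) x * Pi_m D (fst (p n)) x + ?Gm x)
    = (\<Sum>K\<in>cells D. measure lborel (K \<inter> omega D) * (dt_fam t \<phi> n K * fst (p n) (PCell K)))
      + int_omega D ?Gm"
    using fun_cong[OF \<Phi>] by (simp add: \<Phi>_def int_omega_cellwise[OF mesh(1)])
  have "(LINT x|surf \<sigma>. \<Psi> x + ?Gf x)
    = area \<sigma> * (dt_fam t df n \<sigma> * snd (p n) (FFace \<sigma>)) + (LINT x|surf \<sigma>. ?Gf x)"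
    if \<sigma>: "\<sigma> \<in> frac_faces D" for \<sigma>
    unfolding \<Psi>_def facewise_eq_piecewise
  proof (rule integral_surf_add_quadratic[OF ff(1,2) ff_borel \<sigma> ff(3)[OF \<sigma>]])
    show "grad_f D (snd (p n)) \<in> borel_measurable (surf \<sigma>)"
      "integrable (surf \<sigma>) (\<lambda>x. (norm (grad_f D (snd (p n)) x))\<^sup>2)"
      using grads X(2) \<sigma> unfolding hfv_gradients_def by blast+
  qed
  then have gamma_eq: "int_gamma D (\<lambda>x. facewise D (dt_fam t df n) x * Pi_f D (snd (p n)) x + ?Gf x)
    = (\<Sum>\<sigma>\<in>frac_faces D. area \<sigma> * (dt_fam t df n \<sigma> * snd (p n) (FFace \<sigma>))) + int_gamma D ?Gf"
    using fun_cong[OF \<Psi>] by (simp add: int_gamma_def sum.distrib)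
  show ?thesis
    using flow[unfolded flow_eq_def, rule_format, OF p] omega_eq gamma_eq
    by (simp only: power2_norm_eq_inner[symmetric] power2_eq_square[symmetric] mult.assoc)
qed

text \<open>Every integrand on the left is a product of piecewise constant functions, hence again
  piecewise constant. The load is left untouched since it reappears in the estimate.\<close>

lemma mech_eq_sums:
  fixes D :: "(real^'d) disc"
  assumes mesh: "polytopal_mesh D" "fracture_network D"
    and mech: "mech_eq D P t n p u l" and v: "v \<in> U_D0 D"
  shows "(\<Sum>K\<in>cells D. measure lborel (K \<inter> omega D) * (stress D P u K \<bullet> strain D v K)) + stab D P u v
    - (\<Sum>K\<in>cells D. measure lborel (K \<inter> omega D) * (biot_b P * fst p (PCell K) * dvg D v K))
    + (\<Sum>\<sigma>\<in>frac_faces D. area \<sigma> * (snd p (FFace \<sigma>) * normal_part D \<sigma> (jump D v \<sigma>)))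
    + (\<Sum>\<sigma>\<in>frac_faces D. area \<sigma> * (l \<sigma> \<bullet> jump D v \<sigma>))
    = (\<Sum>K\<in>cells D. LINT x:K|lborel. mean_force P t n K \<bullet> Pi_D D v x)"
proof -
  have cells: "finite (cells D)" "disjoint (cells D)"
    using mesh(1) by (auto simp: polytopal_mesh_def)
  note ff = frac_faces_mesh[OF mesh]
  have 1: "(\<lambda>x. cellwise D (stress D P u) x \<bullet> cellwise D (strain D v) x)
    = piecewise (cells D) (\<lambda>K. stress D P u K \<bullet> strain D v K)"
    and 2: "(\<lambda>x. biot_b P * Pi_m D (fst p) x * cellwise D (dvg D v) x)
    = piecewise (cells D) (\<lambda>K. biot_b P * fst p (PCell K) * dvg D v K)"
    unfolding Pi_m_def cellwise_eq_piecewise using cells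
    by (intro piecewise_eqI; auto simp: piecewise_eq piecewise_outside)+
  have 3: "(\<lambda>x. Pi_f D (snd p) x * facewise D (\<lambda>\<sigma>. normal_part D \<sigma> (jump D v \<sigma>)) x)
    = piecewise (frac_faces D) (\<lambda>\<sigma>. snd p (FFace \<sigma>) * normal_part D \<sigma> (jump D v \<sigma>))"
    and 4: "(\<lambda>x. facewise D l x \<bullet> facewise D (jump D v) x)
    = piecewise (frac_faces D) (\<lambda>\<sigma>. l \<sigma> \<bullet> jump D v \<sigma>)"
    unfolding Pi_f_def facewise_eq_piecewise using ff
    by (intro piecewise_eqI; auto simp: piecewise_eq piecewise_outside)+
  show ?thesis
    using mech[unfolded mech_eq_def, rule_format, OF v]
    unfolding 1 2 3 4 int_omega_cellwise[OF mesh(1)] int_gamma_facewise[OF mesh] .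
qed

text \<open>The discrete chain rule is applied on each cell to strain and pressure, with the
  nonnegative weights \<open>measure lborel (K \<inter> omega D)\<close> and
  \<open>1 / biot_M P\<close>, and to the stabilisation as a whole.\<close>

lemma dt_stored_energy_le:
  fixes D :: "(real^'d) disc"
  assumes mesh: "polytopal_mesh D"
    and data: "0 < biot_M P" "\<And>K. K \<in> cells D \<Longrightarrow> 0 < mu P K \<and> 0 < 2 * mu P K + real CARD('d) * lam P K"
    and t: "t (n - 1) < t n"
  shows "dt t (\<lambda>m. int_omega D (\<lambda>x. 1/2 * (cellwise D (stress D P (u m)) x \<bullet> cellwise D (strain D (u m)) x
          + 1 / biot_M P * \<bar>Pi_m D (q m) x\<bar>\<^sup>2)) + 1/2 * stab D P (u m) (u m)) n
    \<le> (\<Sum>K\<in>cells D. measure lborel (K \<inter> omega D) * (stress D P (u n) K \<bullet> strain D (dt_fam t u n) K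
          + 1 / biot_M P * (q n (PCell K) * dt_fam t q n (PCell K)))) + stab D P (u n) (dt_fam t u n)"
proof -
  have cells: "finite (cells D)" "disjoint (cells D)" "\<And>K. K \<in> cells D \<Longrightarrow> bounded K"
    using mesh by (auto simp: polytopal_mesh_def intro: polytopal_bounded)
  \<comment> \<open>The squared pressure is written as an inner product of reals so that
    \<open>dt_half_inner_le\<close> covers it.\<close>
  let ?E = "\<lambda>m K. 1/2 * (stress D P (u m) K \<bullet> strain D (u m) K)
      + 1 / biot_M P * (1/2 * (q m (PCell K) \<bullet> q m (PCell K)))"
  have "(\<lambda>x. 1/2 * (cellwise D (stress D P (u m)) x \<bullet> cellwise D (strain D (u m)) x
          + 1 / biot_M P * \<bar>Pi_m D (q m) x\<bar>\<^sup>2)) = piecewise (cells D) (?E m)" for m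
    unfolding Pi_m_def cellwise_eq_piecewise using cells
    by (intro piecewise_eqI) (auto simp: piecewise_eq piecewise_outside power2_eq_square add_divide_distrib)
  then have "dt t (\<lambda>m. int_omega D (\<lambda>x. 1/2 * (cellwise D (stress D P (u m)) x \<bullet> cellwise D (strain D (u m)) x
          + 1 / biot_M P * \<bar>Pi_m D (q m) x\<bar>\<^sup>2)) + 1/2 * stab D P (u m) (u m)) n
    = (\<Sum>K\<in>cells D. measure lborel (K \<inter> omega D) * (dt t (\<lambda>m. 1/2 * (stress D P (u m) K \<bullet> strain D (u m) K)) n
        + 1 / biot_M P * dt t (\<lambda>m. 1/2 * (q m (PCell K) \<bullet> q m (PCell K))) n))
      + dt t (\<lambda>m. 1/2 * stab D P (u m) (u m)) n"
    by (simp only: int_omega_cellwise[OF mesh] dt_add dt_sum dt_mult)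
  also have "\<dots> \<le> (\<Sum>K\<in>cells D. measure lborel (K \<inter> omega D) * (stress D P (u n) K \<bullet> strain D (dt_fam t u n) K
        + 1 / biot_M P * (q n (PCell K) \<bullet> dt t (\<lambda>m. q m (PCell K)) n)))
      + stab D P (u n) (dt_fam t u n)"
  proof (intro add_mono sum_mono mult_left_mono dt_elastic_energy_le dt_half_inner_le stab_dt_le conjI t)
    fix K assume K: "K \<in> cells D"
    \<comment> \<open>The stabilisation is weighted by 2\<mu> + \<lambda>, whereas the data control
      2\<mu> + d\<lambda>. For negative \<lambda> the former is at least as large, since d \<ge>
      1.\<close>
    show "0 \<le> 2 * mu P K + lam P K"
    proof (cases "0 \<le> lam P K")
      case False
      then have "real CARD('d) * lam P K \<le> 1 * lam P K"
        by (intro mult_right_mono_neg) (auto simp: Suc_leI)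
      then show ?thesis
        using data(2)[OF K] by simp
    qed (use data(2)[OF K] in simp)
  qed (use data cells in auto)
  finally show ?thesis
    by (simp add: dt_fam_def)
qed

section \<open>Energy estimate and aperture bound\<close>

theorem proposition3p3:
  fixes D :: "(real^'d) disc" and P :: "'d model"
    and t :: "nat \<Rightarrow> real" and N :: nat and T :: real
    and p :: "nat \<Rightarrow> ((real^'d) mdof \<Rightarrow> real) \<times> ((real^'d) fdof \<Rightarrow> real)"
    and u :: "nat \<Rightarrow> (real^'d) udof \<Rightarrow> real^'d"
    and l :: "nat \<Rightarrow> (real^'d) set \<Rightarrow> real^'d"
    and \<phi> df :: "nat \<Rightarrow> (real^'d) set \<Rightarrow> real"
    and \<beta>n \<beta>\<tau> :: "(real^'d) set \<Rightarrow> real"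
  assumes dim: "CARD('d) = 2 \<or> CARD('d) = 3"
    and mesh: "polytopal_mesh D" "fracture_network D" "center_weights D"
    and grads: "hfv_gradients D (perm P)"
    and data: "admissible_data D P T"
    and time: "time_grid t N T"
    and betas: "\<forall>\<sigma>\<in>frac_faces D. 0 < \<beta>n \<sigma> \<and> 0 < \<beta>\<tau> \<sigma>"
    and init: "p 0 \<in> X_D D" "u 0 \<in> U_D0 D"
    and spaces: "\<forall>n\<in>{1..N}. p n \<in> X_D0 D \<and> u n \<in> U_D0 D
                   \<and> l n \<in> C_D D P (\<lambda>\<sigma>. normal_part D \<sigma> (l n \<sigma>))"
    and flow: "\<forall>n\<in>{1..N}. flow_eq D P t n p \<phi> df"
    and mech: "\<forall>n\<in>{1..N}. mech_eq D P t n (p n) (u n) (l n)"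
    and contact: "\<forall>n\<in>{1..N}. contact_eq D P t \<beta>n \<beta>\<tau> n u (l n)"
    and coupling: "coupling_laws D P t N p u \<phi> df"
  shows
    "(\<forall>n\<in>{1..N}. (n = 1 \<longrightarrow> (\<forall>\<sigma>\<in>frac_faces D. normal_part D \<sigma> (jump D (u 0) \<sigma>) \<le> 0)) \<longrightarrow>
       dt t (\<lambda>m.
           int_omega D (\<lambda>x. 1/2 * (cellwise D (stress D P (u m)) x \<bullet> cellwise D (strain D (u m)) x
                                + 1 / biot_M P * \<bar>Pi_m D (fst (p m)) x\<bar>\<^sup>2))
           + 1/2 * stab D P (u m) (u m)) n
       + int_gamma D (facewise D (\<lambda>\<sigma>. fric P \<sigma> * normal_part D \<sigma> (l n \<sigma>)
                                * norm (tangent_part D \<sigma> (jump D (dt_fam t u n) \<sigma>))))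
       + int_omega D (\<lambda>x. ((1 / eta P) *\<^sub>R (cellwise D (perm P) x *v grad_m D (fst (p n)) x))
                                \<bullet> grad_m D (fst (p n)) x)
       + int_gamma D (\<lambda>x. facewise D (conductivity (df (n - 1))) x / eta P
                                * (norm (grad_f D (snd (p n)) x))\<^sup>2)
       + (\<Sum>a\<in>{Plus, Minus}. int_gamma D (\<lambda>x. facewise D (transmissivity P (df (n - 1))) x
                                * (pjump D a (p n) x)\<^sup>2))
       \<le> int_omega D (\<lambda>x. h_m P x * Pi_m D (fst (p n)) x)
         + int_gamma D (\<lambda>x. h_f P x * Pi_f D (snd (p n)) x)
         + (\<Sum>K\<in>cells D. LINT x:K|lborel. mean_force P t n K \<bullet> Pi_D D (dt_fam t u n) x))
     \<and> (\<forall>n\<in>{1..N}. \<forall>\<sigma>\<in>frac_faces D. d_c P \<sigma> \<le> df n \<sigma>)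
     \<and> (\<forall>n\<in>{1..N}. (n = 1 \<longrightarrow> (\<forall>\<sigma>\<in>frac_faces D. normal_part D \<sigma> (jump D (u 0) \<sigma>) \<le> 0)) \<longrightarrow>
           (\<forall>\<sigma>\<in>frac_faces D. 0 < conductivity (df (n - 1)) \<sigma> \<and> 0 < transmissivity P (df (n - 1)) \<sigma>))"
proof -
  note ff = frac_faces_mesh[OF mesh(1,2)]
  have fc: "fric P \<sigma> \<ge> 0" "0 < K_fn P \<sigma>" "0 < d_c P \<sigma>" "norm (normal_plus D \<sigma>) = 1"
    if "\<sigma> \<in> frac_faces D" for \<sigma>
    using that data mesh(2) by (auto simp: admissible_data_def fracture_network_def)
  have df: "df n \<sigma> = d_c P \<sigma> - normal_part D \<sigma> (jump D (u n) \<sigma>)"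
    if "n \<le> N" "\<sigma> \<in> frac_faces D" for n \<sigma>
    using coupling that by (auto simp: coupling_laws_def)
  have normal_contact: "0 \<le> normal_part D \<sigma> (l n \<sigma>)" "normal_part D \<sigma> (jump D (u n) \<sigma>) \<le> 0"
    "normal_part D \<sigma> (l n \<sigma>) * normal_part D \<sigma> (jump D (u n) \<sigma>) = 0"
    if "n \<in> {1..N}" "\<sigma> \<in> frac_faces D" for n \<sigma>
  proof -
    have "0 < \<beta>n \<sigma>" and "normal_part D \<sigma> (l n \<sigma>) =
       max 0 (normal_part D \<sigma> (l n \<sigma>) + \<beta>n \<sigma> * normal_part D \<sigma> (jump D (u n) \<sigma>))"
      using that betas contact unfolding contact_eq_def by blast+
    then show "0 \<le> normal_part D \<sigma> (l n \<sigma>)" "normal_part D \<sigma> (jump D (u n) \<sigma>) \<le> 0"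
      "normal_part D \<sigma> (l n \<sigma>) * normal_part D \<sigma> (jump D (u n) \<sigma>) = 0"
      by (rule complementarity)+
  qed
  \<comment> \<open>From the second step on, the previous displacement itself satisfies a contact
    condition. At \<open>n = 1\<close> it is the initial datum, which obeys no contact equation, so
    the sign of its normal jump has to be assumed.\<close>
  have prev: "normal_part D \<sigma> (jump D (u (n - 1)) \<sigma>) \<le> 0"
    if "n \<in> {1..N}" "n = 1 \<longrightarrow> (\<forall>\<sigma>\<in>frac_faces D. normal_part D \<sigma> (jump D (u 0) \<sigma>) \<le> 0)"
      "\<sigma> \<in> frac_faces D" for n \<sigma>
  proof (cases "n = 1")
    case False
    with that(1) have "n - 1 \<in> {1..N}" by auto
    then show ?thesis
      using normal_contact(2) that(3) by blast
  qed (use that in simp)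
  show ?thesis
  proof (intro conjI ballI impI)
    fix n \<sigma> assume "n \<in> {1..N}" "\<sigma> \<in> frac_faces D"
    then show "d_c P \<sigma> \<le> df n \<sigma>"
      using df normal_contact(2) by simp
  next
    fix n \<sigma>
    assume "n \<in> {1..N}" "n = 1 \<longrightarrow> (\<forall>\<sigma>\<in>frac_faces D. normal_part D \<sigma> (jump D (u 0) \<sigma>) \<le> 0)"
      "\<sigma> \<in> frac_faces D"
    \<comment> \<open>Conductivity and transmissivity are evaluated at the previous time, so the
      aperture bound is required at index \<open>n - 1\<close>, possibly \<open>0\<close>.\<close>
    then have "0 < df (n - 1) \<sigma>" "0 < K_fn P \<sigma>"
      using df[of "n - 1" \<sigma>] prev[of n \<sigma>] fc[of \<sigma>] by auto
    then show "0 < conductivity (df (n - 1)) \<sigma>" "0 < transmissivity P (df (n - 1)) \<sigma>"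
      by (simp_all add: conductivity_def transmissivity_def)
  next
    fix n
    assume n: "n \<in> {1..N}" "n = 1 \<longrightarrow> (\<forall>\<sigma>\<in>frac_faces D. normal_part D \<sigma> (jump D (u 0) \<sigma>) \<le> 0)"
    let ?v = "dt_fam t u n"
    let ?m = "\<lambda>K. measure lborel (K \<inter> omega D)"
    have t: "t (n - 1) < t n"
      by (rule time_grid_step[OF time n(1)])
    have u: "u n \<in> U_D0 D" "u (n - 1) \<in> U_D0 D"
    proof -
      have "\<forall>m\<le>N. u m \<in> U_D0 D"
        using spaces init(2) by (metis atLeastAtMost_iff less_one not_le)
      then show "u n \<in> U_D0 D" "u (n - 1) \<in> U_D0 D"
        using n(1) by auto
    qed
    have jump_dt: "normal_part D \<sigma> (jump D ?v \<sigma>) = dt t (\<lambda>m. normal_part D \<sigma> (jump D (u m) \<sigma>)) n"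
      if "\<sigma> \<in> frac_faces D" for \<sigma>
      by (simp add: jump_dt_fam[OF ff(3)[OF that]] normal_part_def dt_def inner_diff_left)
    \<comment> \<open>The contact aperture does not depend on time and drops out of the difference.
      The law for \<open>df\<close> holds from index \<open>0\<close>, which the step
      \<open>n = 1\<close> uses.\<close>
    have aperture: "dt_fam t df n \<sigma> = - normal_part D \<sigma> (jump D ?v \<sigma>)" if "\<sigma> \<in> frac_faces D" for \<sigma>
    proof -
      have "df n \<sigma> = d_c P \<sigma> - normal_part D \<sigma> (jump D (u n) \<sigma>)"
        "df (n - 1) \<sigma> = d_c P \<sigma> - normal_part D \<sigma> (jump D (u (n - 1)) \<sigma>)"
        using n(1) that by (auto intro!: df)
      then show ?thesis
        by (simp add: jump_dt[OF that] dt_fam_def dt_def right_diff_distrib)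
    qed
    \<comment> \<open>The law is stated with the divergence of \<open>?v\<close>, the very test
      function of the mechanical equation, so the Biot terms match without moving the time
      difference through the divergence.\<close>
    have porosity: "dt_fam t \<phi> n K * fst (p n) (PCell K) = biot_b P * fst (p n) (PCell K) * dvg D ?v K
        + 1 / biot_M P * (fst (p n) (PCell K) * dt_fam t (\<lambda>m. fst (p m)) n (PCell K))"
      if "K \<in> cells D" for K
    proof -
      have "dt_fam t \<phi> n K
        = biot_b P * dvg D ?v K + (1 / biot_M P) * dt_fam t (\<lambda>m. fst (p m)) n (PCell K)"
        using coupling n(1) that unfolding coupling_laws_def by blast
      then show ?thesis
        by (simp add: algebra_simps)
    qed
    have "fric P \<sigma> * normal_part D \<sigma> (l n \<sigma>) * norm (tangent_part D \<sigma> (jump D ?v \<sigma>))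
        \<le> l n \<sigma> \<bullet> jump D ?v \<sigma>" if \<sigma>: "\<sigma> \<in> frac_faces D" for \<sigma>
    proof (rule contact_power_ge[OF fc(4)[OF \<sigma>], of "\<beta>\<tau> \<sigma>"])
      \<comment> \<open>Complementarity removes the product of the multiplier with the current
        normal jump. Minus the product with the previous one, over the time step, is left, and
        \<open>prev\<close> makes it nonnegative.\<close>
      have "normal_part D \<sigma> (l n \<sigma>) * normal_part D \<sigma> (jump D ?v \<sigma>)
        = - (normal_part D \<sigma> (l n \<sigma>) * normal_part D \<sigma> (jump D (u (n - 1)) \<sigma>)) / (t n - t (n - 1))"
        using normal_contact(3)[OF n(1) \<sigma>] by (auto simp: jump_dt[OF \<sigma>] dt_def divide_inverse)
      also have "\<dots> \<ge> 0"
        using normal_contact(1)[OF n(1) \<sigma>] prev[OF n \<sigma>] t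
        by (simp add: mult_le_0_iff divide_nonpos_pos)
      finally show "0 \<le> normal_part D \<sigma> (l n \<sigma>) * normal_part D \<sigma> (jump D ?v \<sigma>)" .
    qed (use betas contact n \<sigma> fc(1)[OF \<sigma>] normal_contact(1)[OF n(1) \<sigma>] in
          \<open>auto simp: contact_eq_def\<close>)
    then have "(\<Sum>\<sigma>\<in>frac_faces D. area \<sigma> * (fric P \<sigma> * normal_part D \<sigma> (l n \<sigma>)
          * norm (tangent_part D \<sigma> (jump D ?v \<sigma>))))
        \<le> (\<Sum>\<sigma>\<in>frac_faces D. area \<sigma> * (l n \<sigma> \<bullet> jump D ?v \<sigma>))"
      by (intro sum_mono mult_left_mono) (auto simp: area_def)
    then have friction: "int_gamma D (facewise D (\<lambda>\<sigma>. fric P \<sigma> * normal_part D \<sigma> (l n \<sigma>)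
          * norm (tangent_part D \<sigma> (jump D ?v \<sigma>))))
        \<le> (\<Sum>\<sigma>\<in>frac_faces D. area \<sigma> * (l n \<sigma> \<bullet> jump D ?v \<sigma>))"
      by (simp only: facewise_eq_piecewise int_gamma_facewise[OF mesh(1,2)])
    have flow_n: "flow_eq D P t n p \<phi> df" "p n \<in> X_D0 D" and mech_n: "mech_eq D P t n (p n) (u n) (l n)"
      using flow mech spaces n(1) by auto
    note F = flow_energy_balance[OF mesh(1,2) grads flow_n]
    note M = mech_eq_sums[OF mesh(1,2) mech_n dt_fam_U_D0[OF u, of t]]
    have "dt t (\<lambda>m. int_omega D (\<lambda>x. 1/2 * (cellwise D (stress D P (u m)) x \<bullet> cellwise D (strain D (u m)) x
          + 1 / biot_M P * \<bar>Pi_m D (fst (p m)) x\<bar>\<^sup>2)) + 1/2 * stab D P (u m) (u m)) n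
      \<le> (\<Sum>K\<in>cells D. ?m K * (stress D P (u n) K \<bullet> strain D ?v K
          + 1 / biot_M P * (fst (p n) (PCell K) * dt_fam t (\<lambda>m. fst (p m)) n (PCell K))))
        + stab D P (u n) ?v"
      using data by (intro dt_stored_energy_le mesh t) (auto simp: admissible_data_def)
    moreover have "(\<Sum>K\<in>cells D. ?m K * (dt_fam t \<phi> n K * fst (p n) (PCell K)))
      = (\<Sum>K\<in>cells D. ?m K * (biot_b P * fst (p n) (PCell K) * dvg D ?v K))
        + (\<Sum>K\<in>cells D. ?m K * (1 / biot_M P * (fst (p n) (PCell K) * dt_fam t (\<lambda>m. fst (p m)) n (PCell K))))"
      by (simp only: porosity distrib_left sum.distrib cong: sum.cong)
    moreover have "(\<Sum>\<sigma>\<in>frac_faces D. area \<sigma> * (dt_fam t df n \<sigma> * snd (p n) (FFace \<sigma>)))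
      = - (\<Sum>\<sigma>\<in>frac_faces D. area \<sigma> * (snd (p n) (FFace \<sigma>) * normal_part D \<sigma> (jump D ?v \<sigma>)))"
      by (simp add: aperture sum_negf mult_ac cong: sum.cong)
    \<comment> \<open>Adding \<open>F\<close> and \<open>M\<close> cancels the Biot terms and the
      products of fracture pressure with normal jumps. The stored-energy bound and
      \<open>friction\<close> then finish, and the combination is linear in the sums.\<close>
    ultimately show "dt t (\<lambda>m.
           int_omega D (\<lambda>x. 1/2 * (cellwise D (stress D P (u m)) x \<bullet> cellwise D (strain D (u m)) x
                                + 1 / biot_M P * \<bar>Pi_m D (fst (p m)) x\<bar>\<^sup>2))
           + 1/2 * stab D P (u m) (u m)) n
       + int_gamma D (facewise D (\<lambda>\<sigma>. fric P \<sigma> * normal_part D \<sigma> (l n \<sigma>)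
                                * norm (tangent_part D \<sigma> (jump D (dt_fam t u n) \<sigma>))))
       + int_omega D (\<lambda>x. ((1 / eta P) *\<^sub>R (cellwise D (perm P) x *v grad_m D (fst (p n)) x))
                                \<bullet> grad_m D (fst (p n)) x)
       + int_gamma D (\<lambda>x. facewise D (conductivity (df (n - 1))) x / eta P
                                * (norm (grad_f D (snd (p n)) x))\<^sup>2)
       + (\<Sum>a\<in>{Plus, Minus}. int_gamma D (\<lambda>x. facewise D (transmissivity P (df (n - 1))) x
                                * (pjump D a (p n) x)\<^sup>2))
       \<le> int_omega D (\<lambda>x. h_m P x * Pi_m D (fst (p n)) x)
         + int_gamma D (\<lambda>x. h_f P x * Pi_f D (snd (p n)) x)
         + (\<Sum>K\<in>cells D. LINT x:K|lborel. mean_force P t n K \<bullet> Pi_D D (dt_fam t u n) x)"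
      using F M friction by (simp only: distrib_left sum.distrib)
  qed
qed

end
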